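(* Let $\mathbb{T}^d$ be the $d$-dimensional flat torus and let $f\in C^2(\mathbb{T}^d)$ be real-valued with Hessian $H$. Assume that $f$ has a unique global minimizer $x^*\in\mathbb{T}^d$, with $f(x^* )=0$, and that there are constants $r_0,m,L>0$ such that $mI_d\preceq H(x)$ and $\|H(x)-H(y)\|\le L\|x-y\|$ for all $x,y\in B_{r_0}(x^* )$ (with $r_0$ small enough that $B_{r_0}(x^* )$ is identified with a Euclidean ball in a single coordinate chart). Let $\alpha>1$, let $Z_0,Z_1,\dots$ be independent $N(0,I_d)$ random vectors, and let $\{X_n\}_{n\ge0}$ be defined by $$X_{n+1}=\begin{cases}X_n-H(X_n)^{-1}\nabla f(X_n)+f(X_n)^\alpha Z_n,& H(X_n)\text{ invertible},\\ X_n+f(X_n)^\alpha Z_n,&\text{otherwise},\end{cases}$$ the addition being understood modulo the periodic identification of $\mathbb{T}^d$. Then for every initial condition $X_0\in\mathbb{T}^d$, $$X_n\to x^*\qquad\text{almost surely.}$$ Additionally, for almost every sample path $\omega$ there exists a random time $N=N(\omega)$ such that $\{X_{N+k}(\omega)\}_{k=0}^\infty$ converges to $x^*$ quadratically, in the following sense: there are deterministic constants $r\in(0,r_0)$ and $Q>\frac{L}{2m}$ with $Qr<1$ such that, with $a_0=r$ and $a_{k+1}=Qa_k^2$ for $k\ge0$, for almost every $\omega$ there is $N(\omega)$ with $\|X_{N+k}(\omega)-x^*\|\le a_k$ for all $k\ge0$.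
   Context: $B_\rho(x^* )$ denotes the open ball of radius $\rho$ about $x^*$; for points of $B_{r_0}(x^* )$ the quantity $\|x-y\|$ is the Euclidean norm of the difference in the single coordinate chart. $\|\cdot\|$ on matrices is the operator norm, and $A\preceq B$ means that $B-A$ is positive semidefinite. After each Euclidean update one takes the periodic representative of the resulting point in $\mathbb{T}^d$. The initial point $X_0$ is deterministic. *)

theory Defs
  imports "HOL-Analysis.Analysis" "HOL-Probability.Probability"
begin

definition int_lattice :: "(real ^ 'n::finite) set" where
  "int_lattice = {k. \<forall>i. k $ i \<in> \<int>}"

lemma zero_int_lattice [simp]: "0 \<in> int_lattice"
  by (simp add: int_lattice_def)

lemma uminus_int_lattice_iff [simp]: "- k \<in> int_lattice \<longleftrightarrow> k \<in> int_lattice"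
  by (simp add: int_lattice_def minus_in_Ints_iff)

lemma add_int_lattice: "k \<in> int_lattice \<Longrightarrow> l \<in> int_lattice \<Longrightarrow> k + l \<in> int_lattice"
  by (simp add: int_lattice_def)

lemma diff_int_lattice_commute: "x - y \<in> int_lattice \<longleftrightarrow> y - x \<in> int_lattice"
  using uminus_int_lattice_iff[of "x - y"] by simp

lemma closed_int_lattice: "closed (int_lattice :: (real ^ 'n::finite) set)"
proof -
  have "int_lattice = (\<Inter>i. {k :: real ^ 'n. k $ i \<in> \<int>})"
    by (auto simp: int_lattice_def)
  moreover have "closed {k :: real ^ 'n. k $ i \<in> \<int>}" for i
  proof -
    have "closed ((\<lambda>k :: real ^ 'n. k $ i) -` \<int>)"
      by (intro closed_vimage closed_Ints continuous_intros)
    then show ?thesis by (simp add: vimage_def)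
  qed
  ultimately show ?thesis by (metis closed_INT)
qed

definition torus_rel :: "real ^ 'n::finite \<Rightarrow> real ^ 'n \<Rightarrow> bool" where
  "torus_rel x y \<longleftrightarrow> x - y \<in> int_lattice"

lemma equivp_torus_rel: "equivp torus_rel"
proof (rule equivpI)
  show "reflp torus_rel" by (simp add: reflp_def torus_rel_def)
  show "symp torus_rel"
    by (simp add: symp_def torus_rel_def diff_int_lattice_commute)
  show "transp torus_rel"
    unfolding transp_def torus_rel_def
    by (metis add_int_lattice diff_add_cancel add_diff_eq)
qed

quotient_type (overloaded) 'n torus = "real ^ 'n::finite" / torus_rel
  morphisms torus_rep to_torus
  by (rule equivp_torus_rel)

lemma to_torus_eq_iff: "to_torus x = to_torus y \<longleftrightarrow> x - y \<in> int_lattice"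
  using torus.abs_eq_iff torus_rel_def by blast

lemma to_torus_rep [simp]: "to_torus (torus_rep x) = x"
  using Quotient3_abs_rep Quotient3_torus by fastforce

lemma torus_rep_to_torus: "\<exists>k\<in>int_lattice. torus_rep (to_torus x) = x + k"
  by (metis add.commute diff_add_cancel to_torus_eq_iff to_torus_rep)

lift_definition torus_shift :: "'n::finite torus \<Rightarrow> real ^ 'n \<Rightarrow> 'n torus" is "(+)"
  by (simp add: torus_rel_def)

text \<open>The flat metric: the Euclidean distance of the closest representatives.\<close>

instantiation torus :: (finite) metric_space
begin

definition dist_torus :: "'a torus \<Rightarrow> 'a torus \<Rightarrow> real" where
  "dist_torus x y = infdist (torus_rep x - torus_rep y) int_lattice"

definition uniformity_torus :: "('a torus \<times> 'a torus) filter" where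
  "uniformity_torus = (INF e\<in>{0<..}. principal {(x, y). dist x y < e})"

definition open_torus :: "'a torus set \<Rightarrow> bool" where
  "open_torus U \<longleftrightarrow> (\<forall>x\<in>U. eventually (\<lambda>(x', y). x' = x \<longrightarrow> y \<in> U) uniformity)"

lemma infdist_int_lattice_attained:
  obtains k where "k \<in> int_lattice" "infdist (v :: real ^ 'a) int_lattice = norm (v - k)"
  using infdist_attains_inf[OF closed_int_lattice, of v] zero_int_lattice
  by (metis dist_norm empty_iff)

lemma infdist_int_lattice_le:
  "k \<in> int_lattice \<Longrightarrow> infdist (v :: real ^ 'a) int_lattice \<le> norm (v - k)"
  by (metis dist_norm infdist_le)

instance
proof
  fix x y z :: "'a torus"
  have "dist x y = 0 \<longleftrightarrow> torus_rep x - torus_rep y \<in> int_lattice"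
    unfolding dist_torus_def
    using in_closed_iff_infdist_zero[OF closed_int_lattice] zero_int_lattice
    by (metis empty_iff)
  also have "\<dots> \<longleftrightarrow> x = y"
    by (metis to_torus_eq_iff to_torus_rep)
  finally show "dist x y = 0 \<longleftrightarrow> x = y" .
  obtain k where k: "k \<in> int_lattice"
    "dist x z = norm (torus_rep x - torus_rep z - k)"
    unfolding dist_torus_def by (rule infdist_int_lattice_attained)
  obtain l where l: "l \<in> int_lattice"
    "dist y z = norm (torus_rep y - torus_rep z - l)"
    unfolding dist_torus_def by (rule infdist_int_lattice_attained)
  have "k - l \<in> int_lattice"
    using add_int_lattice[of k "- l"] k(1) l(1) by simp
  then have "dist x y \<le> norm (torus_rep x - torus_rep y - (k - l))"
    unfolding dist_torus_def by (rule infdist_int_lattice_le)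
  also have "\<dots> = norm ((torus_rep x - torus_rep z - k) - (torus_rep y - torus_rep z - l))"
    by (simp add: algebra_simps)
  also have "\<dots> \<le> dist x z + dist y z"
    unfolding k(2) l(2) by (rule norm_triangle_ineq4)
  finally show "dist x y \<le> dist x z + dist y z" .
qed (simp_all only: uniformity_torus_def open_torus_def)

end

lemma dist_to_torus_le: "dist (to_torus x) (to_torus y) \<le> dist x y"
proof -
  obtain k where k: "k \<in> int_lattice" "torus_rep (to_torus x) = x + k"
    using torus_rep_to_torus by blast
  obtain l where l: "l \<in> int_lattice" "torus_rep (to_torus y) = y + l"
    using torus_rep_to_torus by blast
  have "k - l \<in> int_lattice"
    using add_int_lattice[of k "- l"] k(1) l(1) by simp
  then have "dist (to_torus x) (to_torus y) \<le> norm (x + k - (y + l) - (k - l))"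
    unfolding dist_torus_def k(2) l(2) by (rule infdist_int_lattice_le)
  then show ?thesis
    by (simp add: dist_norm algebra_simps)
qed

lemma dist_torus_attained:
  obtains q where "to_torus q = y" "dist (to_torus p) y = dist p q"
proof -
  obtain k where k: "k \<in> int_lattice" "torus_rep (to_torus p) = p + k"
    using torus_rep_to_torus by blast
  obtain l where l: "l \<in> int_lattice"
    "dist (to_torus p) y = norm (torus_rep (to_torus p) - torus_rep y - l)"
    unfolding dist_torus_def by (rule infdist_int_lattice_attained)
  define q where "q = torus_rep y + l - k"
  have "l - k \<in> int_lattice"
    using add_int_lattice[of l "- k"] k(1) l(1) by simp
  then have "to_torus q = to_torus (torus_rep y)"
    unfolding to_torus_eq_iff q_def by simp
  moreover have "dist (to_torus p) y = dist p q"
    unfolding l(2) k(2) q_def dist_norm by (simp add: algebra_simps)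
  ultimately show ?thesis using that by simp
qed

lemma to_torus_image_ball: "to_torus ` ball p r = ball (to_torus p) r"
proof
  show "to_torus ` ball p r \<subseteq> ball (to_torus p) r"
    by (auto intro: le_less_trans[OF dist_to_torus_le])
  show "ball (to_torus p) r \<subseteq> to_torus ` ball p r"
  proof
    fix y assume "y \<in> ball (to_torus p) r"
    moreover obtain q where "to_torus q = y" "dist (to_torus p) y = dist p q"
      by (rule dist_torus_attained)
    ultimately show "y \<in> to_torus ` ball p r" by auto
  qed
qed

text \<open>The \<open>i\<close>-th entry is the partial derivative in direction \<open>i\<close>, so entry
  \<open>(i, j)\<close> of the Hessian is the \<open>j\<close>-th partial derivative of the \<open>i\<close>-th one. These are
  junk values where the derivatives do not exist, which \<open>C2\<close> excludes.\<close>

definition gradient :: "(real ^ 'n::finite \<Rightarrow> real) \<Rightarrow> real ^ 'n \<Rightarrow> real ^ 'n" where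
  "gradient g x = (\<chi> i. frechet_derivative g (at x) (axis i 1))"

definition hessian :: "(real ^ 'n::finite \<Rightarrow> real) \<Rightarrow> real ^ 'n \<Rightarrow> real ^ 'n ^ 'n" where
  "hessian g x = jacobian (gradient g) (at x)"

definition C2 :: "(real ^ 'n::finite \<Rightarrow> real) \<Rightarrow> bool" where
  "C2 g \<longleftrightarrow> (\<forall>x. g differentiable at x) \<and> (\<forall>x. gradient g differentiable at x)
     \<and> continuous_on UNIV (hessian g)"

text \<open>Functions on the torus are differentiated through their periodic lift
  to Euclidean space; the choice of the representative does not matter, see
  \<open>torus_gradient_to_torus\<close> and \<open>torus_hessian_to_torus\<close>.\<close>

definition torus_C2 :: "('n::finite torus \<Rightarrow> real) \<Rightarrow> bool" where
  "torus_C2 f \<longleftrightarrow> C2 (f \<circ> to_torus)"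

definition torus_gradient :: "('n::finite torus \<Rightarrow> real) \<Rightarrow> 'n torus \<Rightarrow> real ^ 'n" where
  "torus_gradient f x = gradient (f \<circ> to_torus) (torus_rep x)"

definition torus_hessian :: "('n::finite torus \<Rightarrow> real) \<Rightarrow> 'n torus \<Rightarrow> real ^ 'n ^ 'n" where
  "torus_hessian f x = hessian (f \<circ> to_torus) (torus_rep x)"

lemma frechet_derivative_periodic:
  fixes g :: "'a::real_normed_vector \<Rightarrow> 'b::real_normed_vector"
  assumes "\<And>x. g (x + k) = g x"
  shows "frechet_derivative g (at (x + k)) = frechet_derivative g (at x)"
proof -
  have shift: "(h has_derivative D) (at x)"
    if "(h has_derivative D) (at (x + l))" and per: "\<And>x. h (x + l) = h x"
    for h :: "'a \<Rightarrow> 'b" and D x l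
  proof -
    have "((\<lambda>x. x + l) has_derivative (\<lambda>x. x)) (at x)"
      by (auto intro!: derivative_eq_intros)
    from has_derivative_compose[OF this that(1)] show ?thesis by (simp add: per)
  qed
  have per': "g (y + - k) = g y" for y
    using assms[of "y + - k"] by simp
  have "(g has_derivative D) (at (x + k)) \<longleftrightarrow> (g has_derivative D) (at x)" for D
    using shift[of g D x k, OF _ assms] shift[of g D "x + k" "- k", OF _ per'] by auto
  then show ?thesis unfolding frechet_derivative_def by simp
qed

lemma gradient_periodic:
  "k \<in> int_lattice \<Longrightarrow> gradient (f \<circ> to_torus) (x + k) = gradient (f \<circ> to_torus) x"
  unfolding gradient_def
  by (subst frechet_derivative_periodic) (auto simp: to_torus_eq_iff intro!: arg_cong[of _ _ f])

lemma hessian_periodic: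
  "k \<in> int_lattice \<Longrightarrow> hessian (f \<circ> to_torus) (x + k) = hessian (f \<circ> to_torus) x"
  unfolding hessian_def jacobian_def
  by (subst frechet_derivative_periodic) (auto simp: gradient_periodic)

lemma torus_gradient_to_torus: "torus_gradient f (to_torus x) = gradient (f \<circ> to_torus) x"
  unfolding torus_gradient_def using torus_rep_to_torus[of x] by (auto simp: gradient_periodic)

lemma torus_hessian_to_torus: "torus_hessian f (to_torus x) = hessian (f \<circ> to_torus) x"
  unfolding torus_hessian_def using torus_rep_to_torus[of x] by (auto simp: hessian_periodic)

definition positive_semidefinite :: "real ^ 'n ^ 'n::finite \<Rightarrow> bool" where
  "positive_semidefinite A \<longleftrightarrow> transpose A = A \<and> (\<forall>v. 0 \<le> v \<bullet> (A *v v))"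

definition loewner_le :: "real ^ 'n ^ 'n::finite \<Rightarrow> real ^ 'n ^ 'n \<Rightarrow> bool"  (infix "\<preceq>" 50) where
  "A \<preceq> B \<longleftrightarrow> positive_semidefinite (B - A)"

definition std_gaussian_vector :: "'w measure \<Rightarrow> ('w \<Rightarrow> real ^ 'n::finite) \<Rightarrow> bool" where
  "std_gaussian_vector M Z \<longleftrightarrow>
     distributed M lborel Z (\<lambda>z. ennreal (\<Prod>i\<in>UNIV. std_normal_density (z $ i)))"

definition noisy_newton_step ::
  "('n::finite torus \<Rightarrow> real) \<Rightarrow> real \<Rightarrow> 'n torus \<Rightarrow> real ^ 'n \<Rightarrow> 'n torus" where
  "noisy_newton_step f \<alpha> x z =
     (if invertible (torus_hessian f x)
      then torus_shift x (- (matrix_inv (torus_hessian f x) *v torus_gradient f x)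
                          + (f x powr \<alpha>) *\<^sub>R z)
      else torus_shift x ((f x powr \<alpha>) *\<^sub>R z))"

primrec noisy_newton ::
  "('n::finite torus \<Rightarrow> real) \<Rightarrow> real \<Rightarrow> (nat \<Rightarrow> 'w \<Rightarrow> real ^ 'n) \<Rightarrow> 'n torus
    \<Rightarrow> nat \<Rightarrow> 'w \<Rightarrow> 'n torus" where
  "noisy_newton f \<alpha> Z x\<^sub>0 0 \<omega> = x\<^sub>0"
| "noisy_newton f \<alpha> Z x\<^sub>0 (Suc n) \<omega> = noisy_newton_step f \<alpha> (noisy_newton f \<alpha> Z x\<^sub>0 n \<omega>) (Z n \<omega>)"

end

theory Submission
  imports Defs
begin

text \<open>
  Let \<open>W\<close> be the event that from some time on the iterates stay within the distances
  \<open>a\<^sub>k\<close>. Near the minimizer the Newton step squares the distance up to the factor \<open>L / m\<close>, while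
  the noise amplitude is \<open>O(|x - p|\<^bsup>2\<alpha>\<^esup>)\<close> with \<open>2\<alpha> > 2\<close>; so, for \<open>r\<close> small, the schedule is
  followed as soon as the Gaussians grow at most geometrically, which happens with probability at
  least \<open>1/2\<close>. Away from the minimizer the noise amplitude is bounded below, hence one step enters the
  \<open>r\<close>-ball with probability bounded below; the unbounded Newton step does no harm because it can be
  reduced modulo the lattice. Hence \<open>P(E \<inter> W) \<ge> \<delta> P(E)\<close> for every event \<open>E\<close> of the past at any
  time. The complement of \<open>W\<close> is a monotone limit of monotone limits of such events \<open>E\<close>, so
  \<open>P(-W) \<le> (1 - \<delta>) P(-W)\<close> and \<open>P(W) = 1\<close>.
  Measurability is obtained on the lifted chain in Euclidean space, where the coordinates of the
  Newton direction are quotients of determinants.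
\<close>

section \<open>The lifted Newton step\<close>

text \<open>The step before reduction modulo the lattice, so that measurability concerns a map
  between Euclidean spaces; \<open>to_torus\<close> carries it to the step on the torus.\<close>

definition lift_step :: "(real ^ 'n::finite \<Rightarrow> real) \<Rightarrow> real \<Rightarrow> real ^ 'n \<Rightarrow> real ^ 'n \<Rightarrow> real ^ 'n" where
  "lift_step g \<alpha> x z =
     x - (if invertible (hessian g x) then matrix_inv (hessian g x) *v gradient g x else 0)
       + (g x powr \<alpha>) *\<^sub>R z"

lemma torus_shift_to_torus: "torus_shift (to_torus x) v = to_torus (x + v)"
  by (rule torus_shift.abs_eq)

lemma to_torus_lift_step:
  "to_torus (lift_step (f \<circ> to_torus) \<alpha> x z) = noisy_newton_step f \<alpha> (to_torus x) z"
  unfolding lift_step_def noisy_newton_step_def torus_gradient_to_torus torus_hessian_to_torus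
    torus_shift_to_torus
  by (simp add: algebra_simps)

lemma matrix_mul_inv_right:
  "invertible A \<Longrightarrow> A ** matrix_inv A = mat 1"
  unfolding invertible_def matrix_inv_def by (rule someI2_ex) auto

text \<open>In the singular case both sides agree because division by \<open>0\<close> yields \<open>0\<close>.\<close>

lemma lift_step_eq_cramer:
  "lift_step g \<alpha> x z =
     x - (\<chi> k. det (\<chi> i j. if j = k then gradient g x $ i else hessian g x $ i $ j)
                / det (hessian g x)) + (g x powr \<alpha>) *\<^sub>R z"
proof (cases "invertible (hessian g x)")
  case True
  then have "hessian g x *v (matrix_inv (hessian g x) *v gradient g x) = gradient g x"
    by (simp add: matrix_vector_mul_assoc matrix_mul_inv_right)
  with True show ?thesis
    by (simp add: lift_step_def cramer invertible_det_nz)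
next
  case False
  then show ?thesis
    by (simp add: lift_step_def invertible_det_nz zero_vec_def)
qed

section \<open>Regularity and Borel measurability of the lifted step\<close>

lemma borel_measurable_vec_iff:
  "f \<in> borel_measurable M \<longleftrightarrow> (\<forall>i. (\<lambda>x. f x $ i :: real) \<in> borel_measurable M)"
  by (subst borel_measurable_euclidean_space) (auto simp: Basis_vec_def inner_axis)

lemma borel_measurable_det:
  fixes A :: "'a \<Rightarrow> real ^ 'n ^ 'n"
  assumes "\<And>i j. (\<lambda>x. A x $ i $ j) \<in> borel_measurable M"
  shows "(\<lambda>x. det (A x)) \<in> borel_measurable M"
  unfolding det_def using assms by measurable

lemma C2_gradient_continuous: "C2 g \<Longrightarrow> continuous_on UNIV (gradient g)"
  by (simp add: C2_def continuous_on_eq_continuous_within differentiable_imp_continuous_within)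

lemma C2_continuous: "C2 g \<Longrightarrow> continuous_on UNIV g"
  by (simp add: C2_def continuous_on_eq_continuous_within differentiable_imp_continuous_within)

lemma has_derivative_gradient:
  assumes "g differentiable at x"
  shows "(g has_derivative (\<lambda>h. gradient g x \<bullet> h)) (at x)"
proof -
  have d: "(g has_derivative frechet_derivative g (at x)) (at x)"
    using assms frechet_derivative_works by blast
  have "frechet_derivative g (at x) h = gradient g x \<bullet> h" for h
  proof -
    have "frechet_derivative g (at x) h = frechet_derivative g (at x) (\<Sum>i\<in>UNIV. h $ i *s axis i 1)"
      by (simp add: basis_expansion)
    also have "\<dots> = (\<Sum>i\<in>UNIV. h $ i * frechet_derivative g (at x) (axis i 1))"
      using has_derivative_linear[OF d]
      by (simp add: linear_sum scalar_mult_eq_scaleR linear_cmul)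
    finally show ?thesis
      by (simp add: gradient_def inner_vec_def mult.commute)
  qed
  then have "frechet_derivative g (at x) = (\<lambda>h. gradient g x \<bullet> h)" by blast
  with d show ?thesis by simp
qed

lemma has_derivative_hessian:
  "gradient g differentiable at x \<Longrightarrow> (gradient g has_derivative (\<lambda>h. hessian g x *v h)) (at x)"
  by (simp add: hessian_def jacobian_works)

text \<open>\<open>matrix_inv\<close> is a choice operator, so measurability goes through Cramer's
  rule: determinants are polynomials in the continuous entries, and real division is Borel
  measurable even where the denominator vanishes, which covers the singular branch.\<close>

lemma measurable_lift_step:
  assumes "C2 g"
  shows "(\<lambda>(x, z). lift_step g \<alpha> x z) \<in> borel_measurable (borel \<Otimes>\<^sub>M borel)"
proof -
  have [measurable]: "g \<in> borel_measurable borel" "gradient g \<in> borel_measurable borel"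
    using assms C2_continuous C2_gradient_continuous by (blast intro: borel_measurable_continuous_onI)+
  have "(\<lambda>x. gradient g x $ i) \<in> borel_measurable borel" for i
    using borel_measurable_vec_iff \<open>gradient g \<in> _\<close> by blast
  moreover have "(\<lambda>x. hessian g x $ i $ j) \<in> borel_measurable borel" for i j
    using assms unfolding C2_def by (intro borel_measurable_continuous_onI continuous_intros) auto
  ultimately have "(\<lambda>x. det (\<chi> i j. if j = k then gradient g x $ i else hessian g x $ i $ j))
      \<in> borel_measurable borel" "(\<lambda>x. det (hessian g x)) \<in> borel_measurable borel" for k
    by (auto intro!: borel_measurable_det)
  then have [measurable]: "(\<lambda>x. \<chi> k. det (\<chi> i j. if j = k then gradient g x $ i else hessian g x $ i $ j)
      / det (hessian g x)) \<in> borel_measurable borel"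
    by (subst borel_measurable_vec_iff) (auto intro!: borel_measurable_divide)
  show ?thesis
    unfolding lift_step_eq_cramer by measurable
qed

text \<open>Cauchy-Schwarz turns the bound on the quadratic form into a lower bound for
  \<open>norm (A *v v)\<close>. This makes the kernel trivial, and later it takes the place of an
  estimate of the inverse by \<open>1 / m\<close>.\<close>

lemma coercive_imp_invertible:
  fixes A :: "real ^ 'n ^ 'n::finite"
  assumes "m > 0" "mat m \<preceq> A"
  shows "invertible A" "m * norm v \<le> norm (A *v v)"
proof -
  have *: "m * norm v \<le> norm (A *v v)" for v
  proof -
    have mat: "mat m *v v = m *\<^sub>R v"
      by (simp add: vec_eq_iff matrix_vector_mult_def mat_def if_distrib[of "\<lambda>c. c * _"]
          cong: if_cong)
    have "0 \<le> v \<bullet> ((A - mat m) *v v)"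
      using assms by (simp add: loewner_le_def positive_semidefinite_def)
    then have "m * (norm v)\<^sup>2 \<le> v \<bullet> (A *v v)"
      by (simp add: matrix_vector_mult_diff_rdistrib inner_diff_right mat power2_norm_eq_inner)
    also have "\<dots> \<le> norm v * norm (A *v v)"
      by (rule norm_cauchy_schwarz)
    finally have "norm v * (m * norm v) \<le> norm v * norm (A *v v)"
      by (simp add: power2_eq_square mult_ac)
    then show ?thesis by (cases "v = 0") auto
  qed
  show "m * norm v \<le> norm (A *v v)" by (rule *)
  have "v = 0" if "A *v v = 0" for v
    using *[of v] that assms(1) by (simp add: mult_le_0_iff)
  then show "invertible A"
    by (simp add: invertible_left_inverse matrix_left_invertible_ker)
qed

text \<open>Multiplying the new error by \<open>hessian g x\<close> removes the inverse. Since the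
  gradient vanishes at \<open>p\<close>, the result is the increment from \<open>p\<close> to
  \<open>x\<close> of \<open>\<lambda>\<xi>. ?H *v \<xi> - gradient g \<xi>\<close>, with
  \<open>?H\<close> the Hessian frozen at \<open>x\<close>. The derivative of this map is a
  difference of Hessians, controlled by the Lipschitz bound; coercivity then divides by
  \<open>m\<close>.\<close>

lemma newton_step_quadratic:
  fixes g :: "real ^ 'n::finite \<Rightarrow> real"
  assumes C2: "C2 g" and m: "m > 0" and crit: "gradient g p = 0"
    and convex: "\<And>x. x \<in> ball p \<rho> \<Longrightarrow> mat m \<preceq> hessian g x"
    and lip: "\<And>x y. x \<in> ball p \<rho> \<Longrightarrow> y \<in> ball p \<rho> \<Longrightarrow>
      onorm ((*v) (hessian g x - hessian g y)) \<le> L * norm (x - y)"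
    and L: "L \<ge> 0" and x: "x \<in> ball p \<rho>"
  shows "norm (x - (if invertible (hessian g x) then matrix_inv (hessian g x) *v gradient g x else 0) - p)
     \<le> L / m * (norm (x - p))\<^sup>2"
proof -
  let ?H = "hessian g x"
  have inv: "invertible ?H" and bd: "\<And>v. m * norm v \<le> norm (?H *v v)"
    using coercive_imp_invertible[OF m convex[OF x]] by auto
  have seg: "\<xi> \<in> ball p \<rho>" "norm (x - \<xi>) \<le> norm (x - p)" if "\<xi> \<in> closed_segment p x" for \<xi>
  proof -
    show "norm (x - \<xi>) \<le> norm (x - p)"
      using segment_bound(2)[OF that] by (simp add: norm_minus_commute)
    have "p \<in> ball p \<rho>" using x by (simp add: dist_norm) (metis le_less_trans norm_ge_zero)
    then show "\<xi> \<in> ball p \<rho>"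
      using closed_segment_subset[of p "ball p \<rho>" x] x that by auto
  qed
  have der: "((\<lambda>\<xi>. ?H *v \<xi> - gradient g \<xi>) has_derivative (\<lambda>h. (?H - hessian g \<xi>) *v h))
      (at \<xi> within closed_segment p x)" for \<xi>
  proof -
    have "((\<lambda>\<xi>. ?H *v \<xi> - gradient g \<xi>) has_derivative (\<lambda>h. ?H *v h - hessian g \<xi> *v h)) (at \<xi>)"
      using C2 by (intro has_derivative_diff has_derivative_hessian linear_imp_has_derivative)
         (auto simp: C2_def)
    then show ?thesis
      by (simp add: matrix_vector_mult_diff_rdistrib has_derivative_at_withinI)
  qed
  \<comment> \<open>The mean value inequality uses the largest slope on the segment instead of
    averaging it, which costs a factor 2 against the sharp constant
    \<open>L / (2 * m)\<close>.\<close>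
  have "norm ((?H *v x - gradient g x) - (?H *v p - gradient g p)) \<le> (L * norm (x - p)) * norm (x - p)"
  proof (rule differentiable_bound[OF convex_closed_segment der])
    fix \<xi> assume \<xi>: "\<xi> \<in> closed_segment p x"
    then have "onorm ((*v) (?H - hessian g \<xi>)) \<le> L * norm (x - \<xi>)"
      using lip x seg(1) by blast
    also have "\<dots> \<le> L * norm (x - p)"
      using seg(2)[OF \<xi>] L by (rule mult_left_mono)
    finally show "onorm ((*v) (?H - hessian g \<xi>)) \<le> L * norm (x - p)" .
  qed auto
  moreover have "?H *v (x - matrix_inv ?H *v gradient g x - p)
      = (?H *v x - gradient g x) - (?H *v p - gradient g p)"
    using inv crit by (simp add: matrix_vector_mult_diff_distrib matrix_vector_mul_assoc matrix_mul_inv_right)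
  ultimately have "m * norm (x - matrix_inv ?H *v gradient g x - p) \<le> L * (norm (x - p))\<^sup>2"
    using bd[of "x - matrix_inv ?H *v gradient g x - p"] by (simp add: power2_eq_square mult_ac)
  then show ?thesis
    using inv m by (simp add: field_simps)
qed

text \<open>Two mean value inequalities descending from the Hessian: bounded on the ball, it forces
  at most linear growth of the gradient from its zero at \<open>p\<close>, hence at most quadratic
  growth of \<open>g\<close>. This gives the noise amplitude the order \<open>2 * \<alpha>\<close>
  in the distance.\<close>

lemma quadratic_upper_bound:
  fixes g :: "real ^ 'n::finite \<Rightarrow> real"
  assumes C2: "C2 g" and "g p = 0" and crit: "gradient g p = 0"
    and lip: "\<And>x y. x \<in> ball p \<rho> \<Longrightarrow> y \<in> ball p \<rho> \<Longrightarrow>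
      onorm ((*v) (hessian g x - hessian g y)) \<le> L * norm (x - y)"
    and L: "L \<ge> 0" and x: "x \<in> ball p \<rho>"
  shows "g x \<le> (onorm ((*v) (hessian g p)) + L * \<rho>) * (norm (x - p))\<^sup>2"
proof -
  define B where "B = onorm ((*v) (hessian g p)) + L * \<rho>"
  have p: "p \<in> ball p \<rho>" using x by (simp add: dist_norm) (metis le_less_trans norm_ge_zero)
  have B0: "B \<ge> 0" using p L unfolding B_def
    by (auto intro!: add_nonneg_nonneg onorm_pos_le matrix_vector_mul_bounded_linear)
  have hess: "onorm ((*v) (hessian g y)) \<le> B" if y: "y \<in> ball p \<rho>" for y
  proof -
    have "onorm (\<lambda>v. hessian g p *v v + (hessian g y - hessian g p) *v v)
        \<le> onorm ((*v) (hessian g p)) + onorm ((*v) (hessian g y - hessian g p))"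
      by (intro onorm_triangle matrix_vector_mul_bounded_linear)
    moreover have "(\<lambda>v. hessian g p *v v + (hessian g y - hessian g p) *v v) = (*v) (hessian g y)"
      by (simp add: fun_eq_iff matrix_vector_mult_diff_rdistrib)
    moreover have "onorm ((*v) (hessian g y - hessian g p)) \<le> L * norm (y - p)"
      using lip y p by blast
    moreover have "\<dots> \<le> L * \<rho>"
      using y L by (intro mult_left_mono) (auto simp: dist_norm norm_minus_commute)
    ultimately show ?thesis by (simp add: B_def)
  qed
  have grad: "norm (gradient g y) \<le> B * norm (y - p)" if y: "y \<in> ball p \<rho>" for y
  proof -
    have "(gradient g has_derivative (\<lambda>h. hessian g z *v h)) (at z within ball p \<rho>)" for z
      using C2 has_derivative_at_withinI has_derivative_hessian unfolding C2_def by blast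
    from differentiable_bound[OF convex_ball this hess y p]
    have "norm (gradient g y - gradient g p) \<le> B * norm (y - p)"
      by blast
    then show ?thesis by (simp add: crit)
  qed
  have "norm (g x - g p) \<le> B * norm (x - p) * norm (x - p)"
  proof (rule differentiable_bound[where S = "cball p (norm (x - p))"])
    fix y assume y: "y \<in> cball p (norm (x - p))"
    show "(g has_derivative (\<lambda>h. gradient g y \<bullet> h)) (at y within cball p (norm (x - p)))"
      using C2 by (auto simp: C2_def intro!: has_derivative_at_withinI has_derivative_gradient)
    have yp: "norm (y - p) \<le> norm (x - p)" using y by (simp add: dist_norm norm_minus_commute)
    then have "y \<in> ball p \<rho>" using x by (simp add: dist_norm norm_minus_commute)
    then have "norm (gradient g y) \<le> B * norm (y - p)" by (rule grad)
    also have "\<dots> \<le> B * norm (x - p)" using yp B0 by (rule mult_left_mono)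
    finally show "onorm (\<lambda>h. gradient g y \<bullet> h) \<le> B * norm (x - p)"
      by (intro onorm_le) (simp, meson Cauchy_Schwarz_ineq2 order_trans mult_right_mono norm_ge_zero)
  qed (simp_all add: dist_norm norm_minus_commute)
  then show ?thesis
    using \<open>g p = 0\<close> by (simp add: B_def power2_eq_square)
qed

section \<open>Gaussian vectors\<close>

definition gauss :: "(real ^ 'n::finite) measure" where
  "gauss = density lborel (\<lambda>z. ennreal (\<Prod>i\<in>UNIV. std_normal_density (z $ i)))"

lemma gauss_density_measurable:
  "(\<lambda>z :: real ^ 'n::finite. ennreal (\<Prod>i\<in>UNIV. std_normal_density (z $ i))) \<in> borel_measurable borel"
proof -
  have [measurable]: "(\<lambda>z :: real ^ 'n. z $ i) \<in> borel_measurable borel" for i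
    by (intro borel_measurable_continuous_onI continuous_intros)
  show ?thesis by measurable
qed

lemma sets_gauss [measurable_cong]: "sets gauss = sets borel"
  by (simp add: gauss_def)

lemma space_gauss [simp]: "space gauss = UNIV"
  by (simp add: gauss_def)

lemma std_gaussian_vector_distr:
  assumes "std_gaussian_vector M Z"
  shows "Z \<in> borel_measurable M" "distr M borel Z = gauss"
proof -
  have d: "distributed M lborel Z (\<lambda>z. ennreal (\<Prod>i\<in>UNIV. std_normal_density (z $ i)))"
    using assms by (simp add: std_gaussian_vector_def)
  show "Z \<in> borel_measurable M"
    using distributed_measurable[OF d] by simp
  have "distr M borel Z = distr M lborel Z"
    by (rule distr_cong) simp_all
  also have "\<dots> = gauss"
    using distributed_distr_eq_density[OF d] by (simp add: gauss_def)
  finally show "distr M borel Z = gauss" .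
qed

lemma nn_integral_lborel_prod_vec:
  fixes f :: "'n::finite \<Rightarrow> real \<Rightarrow> real"
  assumes "\<And>i. f i \<in> borel_measurable borel" "\<And>i x. 0 \<le> f i x"
  shows "(\<integral>\<^sup>+z. ennreal (\<Prod>i\<in>UNIV. f i (z $ i)) \<partial>lborel) = (\<Prod>i\<in>UNIV. \<integral>\<^sup>+x. ennreal (f i x) \<partial>lborel)"
proof -
  let ?ax = "\<lambda>i :: 'n. axis i 1 :: real ^ 'n"
  have inj: "inj ?ax" by (auto simp: inj_def axis_eq_axis)
  have B: "Basis = ?ax ` UNIV" by (auto simp: Basis_vec_def)
  define h where "h b = f (inv ?ax b)" for b
  have h: "h (?ax i) = f i" for i unfolding h_def by (simp add: inv_f_f[OF inj])
  have "(\<integral>\<^sup>+z. ennreal (\<Prod>b\<in>Basis. h b (z \<bullet> b)) \<partial>lborel) = (\<Prod>b\<in>Basis. \<integral>\<^sup>+x. ennreal (h b x) \<partial>lborel)"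
    using assms by (subst nn_integral_lborel_prod[symmetric]) (auto simp: h_def prod_ennreal)
  then show ?thesis
    by (simp add: B prod.reindex[OF inj] h inner_axis)
qed

text \<open>Times the density, each \<open>(z $ j)\<^sup>2\<close> is again a product over the
  coordinates, with the extra factor placed on coordinate \<open>j\<close> by \<open>f j\<close>.
  The integral therefore splits into one-dimensional Gaussian moments, each finite.\<close>

lemma gauss_second_moment: "(\<integral>\<^sup>+z. ennreal ((norm z)\<^sup>2) \<partial>(gauss :: (real ^ 'n::finite) measure)) < \<infinity>"
proof -
  define f where "f j i = (\<lambda>x::real. if i = j then std_normal_density x * x ^ 2 else std_normal_density x)"
    for i j :: 'n
  have [measurable]: "f j i \<in> borel_measurable borel" for i j by (simp add: f_def)
  have [measurable]: "(\<lambda>z :: real ^ 'n. z $ i) \<in> borel_measurable borel" for i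
    by (intro borel_measurable_continuous_onI continuous_intros)
  have f0: "0 \<le> f j i x" for i j x by (simp add: f_def)
  have fin: "(\<integral>\<^sup>+x. ennreal (f j i x) \<partial>lborel) < \<infinity>" for i j
  proof -
    have "integrable lborel (f j i)"
      using integrable_std_normal_moment[of 2] integrable_std_normal_moment[of 0]
      by (cases "i = j") (simp_all add: f_def)
    then show ?thesis
      using f0 by (simp add: integrable_iff_bounded)
  qed
  have eq: "(\<Prod>i\<in>UNIV. std_normal_density (z $ i)) * (norm z)\<^sup>2 = (\<Sum>j\<in>UNIV. \<Prod>i\<in>UNIV. f j i (z $ i))"
    for z :: "real ^ 'n"
  proof -
    have "(\<Prod>i\<in>UNIV. f j i (z $ i)) = (\<Prod>i\<in>UNIV. std_normal_density (z $ i)) * (z $ j)\<^sup>2" for j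
    proof -
      have "f j i (z $ i) = std_normal_density (z $ i) * (if i = j then (z $ j)\<^sup>2 else 1)" for i
        by (simp add: f_def)
      then show ?thesis by (simp add: prod.distrib)
    qed
    then show ?thesis
      unfolding power2_norm_eq_inner inner_vec_def
      by (simp add: sum_distrib_left power2_eq_square)
  qed
  have "(\<integral>\<^sup>+z. ennreal ((norm z)\<^sup>2) \<partial>(gauss :: (real ^ 'n) measure))
      = (\<integral>\<^sup>+z. ennreal (\<Prod>i\<in>UNIV. std_normal_density (z $ i)) * ennreal ((norm z)\<^sup>2) \<partial>(lborel :: (real ^ 'n) measure))"
    unfolding gauss_def using gauss_density_measurable by (subst nn_integral_density) simp_all
  also have "\<dots> = (\<integral>\<^sup>+z. ennreal (\<Sum>j\<in>UNIV. \<Prod>i\<in>UNIV. f j i (z $ i)) \<partial>(lborel :: (real ^ 'n) measure))"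
    by (intro nn_integral_cong) (simp add: eq ennreal_mult[symmetric] prod_nonneg)
  also have "\<dots> = (\<integral>\<^sup>+z. (\<Sum>j\<in>UNIV. ennreal (\<Prod>i\<in>UNIV. f j i (z $ i))) \<partial>(lborel :: (real ^ 'n) measure))"
    by (intro nn_integral_cong) (simp add: f0 prod_nonneg sum_ennreal)
  also have "\<dots> = (\<Sum>j\<in>UNIV. \<integral>\<^sup>+z. ennreal (\<Prod>i\<in>UNIV. f j i (z $ i)) \<partial>(lborel :: (real ^ 'n) measure))"
    by (rule nn_integral_sum) measurable
  also have "\<dots> = (\<Sum>j\<in>UNIV. \<Prod>i\<in>UNIV. \<integral>\<^sup>+x. ennreal (f j i x) \<partial>lborel)"
    using f0 by (subst nn_integral_lborel_prod_vec) simp_all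
  also have "\<dots> < \<infinity>"
    using fin by (simp add: ennreal_prod_eq_top less_top[symmetric] top_unique) 
  finally show ?thesis .
qed

text \<open>The point is uniformity in the centre: all these balls lie within norm
  \<open>R + \<rho>\<close>, where the density is bounded below by a positive constant, and they
  share one volume.\<close>

lemma gauss_cball_lower_bound:
  assumes "\<rho> > 0"
  obtains \<delta> where "\<delta> > 0" "\<And>c :: real ^ 'n::finite. norm c \<le> R \<Longrightarrow> ennreal \<delta> \<le> emeasure gauss (cball c \<rho>)"
proof
  \<comment> \<open>The one-dimensional density at \<open>R + \<rho>\<close>; it bounds each factor
    from below because a coordinate never exceeds the norm in absolute value.\<close>
  define \<kappa> where "\<kappa> = exp (- (R + \<rho>)\<^sup>2 / 2) / sqrt (2 * pi)"
  let ?vol = "unit_ball_vol (real DIM(real ^ 'n)) * \<rho> ^ DIM(real ^ 'n)"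
  have "\<kappa> > 0" by (simp add: \<kappa>_def)
  then show "\<kappa> ^ CARD('n) * ?vol > 0" using assms by simp
  fix c :: "real ^ 'n" assume c: "norm c \<le> R"
  have dens: "\<kappa> ^ CARD('n) \<le> (\<Prod>i\<in>UNIV. std_normal_density (z $ i))" if "z \<in> cball c \<rho>" for z
  proof -
    have "norm z \<le> R + \<rho>"
      using that c norm_triangle_ineq2[of z c] by (simp add: dist_norm norm_minus_commute)
    then have "\<bar>z $ i\<bar> \<le> R + \<rho>" for i
      using component_le_norm_cart[of z i] by simp
    then have "(z $ i)\<^sup>2 \<le> (R + \<rho>)\<^sup>2" for i
      by (metis abs_ge_zero power2_abs power_mono)
    then have "\<kappa> \<le> std_normal_density (z $ i)" for i
      by (simp add: \<kappa>_def std_normal_density_def divide_right_mono)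
    then have "(\<Prod>i\<in>(UNIV::'n set). \<kappa>) \<le> (\<Prod>i\<in>UNIV. std_normal_density (z $ i))"
      using \<open>\<kappa> > 0\<close> by (intro prod_mono) simp
    then show ?thesis by simp
  qed
  have "ennreal (\<kappa> ^ CARD('n) * ?vol) = ennreal (\<kappa> ^ CARD('n)) * emeasure lborel (cball c \<rho>)"
    using assms \<open>\<kappa> > 0\<close> by (simp add: emeasure_cball ennreal_mult)
  also have "\<dots> = (\<integral>\<^sup>+z. ennreal (\<kappa> ^ CARD('n)) * indicator (cball c \<rho>) z \<partial>lborel)"
    by (simp add: nn_integral_cmult_indicator)
  also have "\<dots> \<le> (\<integral>\<^sup>+z. ennreal (\<Prod>i\<in>UNIV. std_normal_density (z $ i)) * indicator (cball c \<rho>) z \<partial>lborel)"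
    using dens by (intro nn_integral_mono) (auto simp: indicator_def intro!: ennreal_leI)
  also have "\<dots> = emeasure gauss (cball c \<rho>)"
    unfolding gauss_def using gauss_density_measurable by (subst emeasure_density) simp_all
  finally show "ennreal (\<kappa> ^ CARD('n) * ?vol) \<le> emeasure gauss (cball c \<rho>)" .
qed

text \<open>Chebyshev's inequality against the growing thresholds \<open>T / s ^ k\<close> gives
  summable tails, and a union bound does the rest. As all \<open>Z n\<close> have the same law, one
  \<open>T\<close> serves every starting time \<open>n\<close>.\<close>

lemma (in prob_space) gauss_tails:
  fixes Z :: "nat \<Rightarrow> 'a \<Rightarrow> real ^ 'n::finite"
  assumes Z: "\<And>n. std_gaussian_vector M (Z n)" and s: "0 < s" "s < 1"
  obtains T where "T > 0" "\<And>n. 1 / 2 \<le> prob {\<omega> \<in> space M. \<forall>k. norm (Z (n + k) \<omega>) \<le> T / s ^ k}"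
proof -
  have [measurable]: "Z n \<in> borel_measurable M" for n
    using std_gaussian_vector_distr(1)[OF Z] .
  obtain V where V: "V > 0" "(\<integral>\<^sup>+z. ennreal ((norm z)\<^sup>2) \<partial>(gauss :: (real ^ 'n) measure)) \<le> ennreal V"
  proof -
    obtain v where "v \<ge> 0" "(\<integral>\<^sup>+z. ennreal ((norm z)\<^sup>2) \<partial>(gauss :: (real ^ 'n) measure)) = ennreal v"
      using gauss_second_moment by (metis ennreal_cases infinity_ennreal_def order_less_irrefl)
    then show thesis by (intro that[of "v + 1"]) (auto intro: ennreal_leI)
  qed
  have tail: "prob {\<omega> \<in> space M. norm (Z n \<omega>) > t} \<le> V / t\<^sup>2" if t: "t > 0" for n t
  proof -
    have "emeasure M {\<omega> \<in> space M. norm (Z n \<omega>) > t}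
        \<le> emeasure M {\<omega> \<in> space M. 1 \<le> ennreal (1 / t\<^sup>2) * ennreal ((norm (Z n \<omega>))\<^sup>2)}"
    proof (intro emeasure_mono Collect_mono)
      have "1 \<le> ennreal (1 / t\<^sup>2) * ennreal ((norm (Z n \<omega>))\<^sup>2)" if "norm (Z n \<omega>) > t" for \<omega>
      proof -
        have "t\<^sup>2 \<le> (norm (Z n \<omega>))\<^sup>2" using that t by (intro power_mono) auto
        then show ?thesis using t by (simp add: ennreal_mult[symmetric] field_simps)
      qed
      then show "\<omega> \<in> space M \<and> t < norm (Z n \<omega>) \<longrightarrow>
          \<omega> \<in> space M \<and> 1 \<le> ennreal (1 / t\<^sup>2) * ennreal ((norm (Z n \<omega>))\<^sup>2)" for \<omega> by blast
    qed measurable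
    also have "\<dots> \<le> ennreal (1 / t\<^sup>2) * (\<integral>\<^sup>+\<omega>. ennreal ((norm (Z n \<omega>))\<^sup>2) \<partial>M)"
      using nn_integral_Markov_inequality[of "\<lambda>\<omega>. ennreal ((norm (Z n \<omega>))\<^sup>2)" "space M" M "ennreal (1 / t\<^sup>2)"]
      by (simp cong: nn_integral_cong_simp)
    also have "(\<integral>\<^sup>+\<omega>. ennreal ((norm (Z n \<omega>))\<^sup>2) \<partial>M) = (\<integral>\<^sup>+z. ennreal ((norm z)\<^sup>2) \<partial>(gauss :: (real ^ 'n) measure))"
      by (subst std_gaussian_vector_distr(2)[OF Z[of n], symmetric]) (simp add: nn_integral_distr)
    also have "ennreal (1 / t\<^sup>2) * \<dots> \<le> ennreal (1 / t\<^sup>2) * ennreal V"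
      by (intro mult_left_mono V) simp
    also have "\<dots> = ennreal (V / t\<^sup>2)"
      using V by (simp add: ennreal_mult[symmetric])
    finally show ?thesis
      using V t by (simp add: emeasure_eq_measure)
  qed
  \<comment> \<open>With this choice the geometric series of
    \<open>V / T\<^sup>2 * (s\<^sup>2) ^ k\<close> sums to exactly \<open>1 / 2\<close>.\<close>
  define T where "T = sqrt (2 * V / (1 - s\<^sup>2))"
  have s2: "s\<^sup>2 < 1" using s by (simp add: power_less_one_iff)
  have T: "T > 0" "T\<^sup>2 = 2 * V / (1 - s\<^sup>2)" using V s2 by (simp_all add: T_def)
  have "1 / 2 \<le> prob {\<omega> \<in> space M. \<forall>k. norm (Z (n + k) \<omega>) \<le> T / s ^ k}" for n
  proof -
    define B where "B k = {\<omega> \<in> space M. norm (Z (n + k) \<omega>) > T / s ^ k}" for k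
    have [measurable]: "B k \<in> events" for k unfolding B_def by measurable
    have B: "prob (B k) \<le> V / T\<^sup>2 * (s\<^sup>2) ^ k" for k
    proof -
      have "prob (B k) \<le> V / (T / s ^ k)\<^sup>2"
        unfolding B_def using T(1) s(1) by (intro tail) simp
      also have "\<dots> = V / T\<^sup>2 * (s\<^sup>2) ^ k"
        by (simp add: power_divide power_mult[symmetric] mult.commute)
      finally show ?thesis .
    qed
    have sums: "(\<lambda>k. V / T\<^sup>2 * (s\<^sup>2) ^ k) sums (V / T\<^sup>2 * (1 / (1 - s\<^sup>2)))"
      using s2 by (intro sums_mult geometric_sums) simp
    have summ: "summable (\<lambda>k. prob (B k))"
      using B by (intro summable_comparison_test'[OF sums_summable[OF sums], of 0]) simp
    have "prob (\<Union>k. B k) \<le> (\<Sum>k. prob (B k))"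
      by (rule finite_measure_subadditive_countably[OF _ summ]) auto
    also have "\<dots> \<le> (\<Sum>k. V / T\<^sup>2 * (s\<^sup>2) ^ k)"
      using B summ sums by (intro suminf_le) (auto simp: sums_iff)
    also have "\<dots> = V / T\<^sup>2 * (1 / (1 - s\<^sup>2))" using sums by (simp add: sums_iff)
    also have "\<dots> = 1 / 2" using s2 V by (simp add: T(2))
    finally have "prob (\<Union>k. B k) \<le> 1 / 2" .
    moreover have "{\<omega> \<in> space M. \<forall>k. norm (Z (n + k) \<omega>) \<le> T / s ^ k} = space M - (\<Union>k. B k)"
      by (auto simp: B_def linorder_not_less[symmetric])
    ultimately show ?thesis by (simp add: prob_compl)
  qed
  with T(1) that show thesis by blast
qed

section \<open>Capture of noise-driven chains\<close>

text \<open>An elementary substitute for the Levy zero-one law.\<close>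

lemma (in prob_space) prob_liminf_eq_1:
  fixes F :: "nat \<Rightarrow> 'a measure" and B :: "nat \<Rightarrow> nat \<Rightarrow> 'a set"
  assumes F: "\<And>n. sets (F n) \<subseteq> events" "\<And>n. space (F n) = space M"
    and mono: "\<And>m n. m \<le> n \<Longrightarrow> sets (F m) \<subseteq> sets (F n)"
    and B: "\<And>n k. B n k \<in> sets (F (n + k))"
    and \<delta>: "\<delta> > 0"
      "\<And>n E. E \<in> sets (F n) \<Longrightarrow> \<delta> * prob E \<le> prob (E \<inter> (\<Union>n. \<Inter>k. B n k))"
  shows "prob (\<Union>n. \<Inter>k. B n k) = 1"
proof -
  have [measurable]: "B n k \<in> events" for n k using F B by blast
  define W where "W = (\<Union>n. \<Inter>k. B n k)"
  define G where "G = space M - W"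
  have [measurable]: "W \<in> events" "G \<in> events" unfolding W_def G_def by measurable
  have ev: "prob (E \<inter> G) \<le> (1 - \<delta>) * prob E" if E: "E \<in> sets (F n)" for E n
  proof -
    have E': "E \<in> events" using E F by blast
    then have "prob E = prob (E \<inter> W) + prob (E \<inter> G)"
      using sets.sets_into_space[OF E']
      by (subst finite_measure_Union[symmetric]) (auto simp: G_def intro!: arg_cong[where f = prob])
    then show ?thesis using \<delta>(2)[OF E] by (simp add: W_def algebra_simps)
  qed
  \<comment> \<open>\<open>A n k\<close> records failure of run \<open>n\<close> within
    \<open>k\<close> steps. \<open>C N K\<close> joins the first \<open>N + 1\<close> runs and is
    decided at time \<open>N + K\<close>, so the bound \<open>ev\<close> applies to it; it increases
    in \<open>K\<close> to \<open>D N\<close>, which decreases in \<open>N\<close> to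
    \<open>G\<close>.\<close>
  define A where "A n k = space M - (\<Inter>j\<le>k. B n j)" for n k
  define C where "C N K = (\<Inter>n\<le>N. A n K)" for N K
  define D where "D N = (\<Union>K. C N K)" for N
  have AF: "A n K \<in> sets (F (N + K))" if "n \<le> N" for n N K
  proof -
    have "B n j \<in> sets (F (N + K))" if "j \<le> K" for j
      using B mono[of "n + j" "N + K"] \<open>n \<le> N\<close> that by auto
    then have "(\<Inter>j\<le>K. B n j) \<in> sets (F (N + K))" by auto
    then show ?thesis unfolding A_def F(2)[of "N + K", symmetric] by blast
  qed
  then have CF: "C N K \<in> sets (F (N + K))" for N K
    unfolding C_def by auto
  then have [measurable]: "C N K \<in> events" for N K using F by blast
  have [measurable]: "D N \<in> events" for N unfolding D_def by measurable
  have incC: "incseq (C N)" for N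
  proof (rule incseq_SucI)
    have "A n K \<subseteq> A n (Suc K)" for n K
      unfolding A_def by (intro Diff_mono INT_anti_mono) auto
    then show "C N K \<subseteq> C N (Suc K)" for K
      unfolding C_def by blast
  qed
  have DG: "D N = (\<Inter>n\<le>N. space M - (\<Inter>k. B n k))" for N
  proof
    show "D N \<subseteq> (\<Inter>n\<le>N. space M - (\<Inter>k. B n k))"
      unfolding D_def C_def A_def by auto
    show "(\<Inter>n\<le>N. space M - (\<Inter>k. B n k)) \<subseteq> D N"
    proof
      fix \<omega> assume \<omega>: "\<omega> \<in> (\<Inter>n\<le>N. space M - (\<Inter>k. B n k))"
      then have "\<forall>n\<le>N. \<exists>k. \<omega> \<notin> B n k" by auto
      then obtain k where k: "\<And>n. n \<le> N \<Longrightarrow> \<omega> \<notin> B n (k n)" by metis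
      have "k n \<le> Max (k ` {..N})" if "n \<le> N" for n using that by (intro Max_ge) auto
      with k have "\<exists>j\<le>Max (k ` {..N}). \<omega> \<notin> B n j" if "n \<le> N" for n using that by blast
      with \<omega> have "\<omega> \<in> C N (Max (k ` {..N}))"
        unfolding C_def A_def by fastforce
      then show "\<omega> \<in> D N" by (auto simp: D_def)
    qed
  qed
  have decD: "decseq D"
    unfolding DG by (intro decseq_SucI INT_anti_mono) auto
  have GD: "G = (\<Inter>N. D N)"
    unfolding DG G_def W_def by auto
  have Dev: "prob (D N \<inter> G) \<le> (1 - \<delta>) * prob (D N)" for N
  proof (rule LIMSEQ_le)
    show "(\<lambda>K. prob (C N K \<inter> G)) \<longlonglongrightarrow> prob (D N \<inter> G)"
    proof -
      have "(\<lambda>K. prob (C N K \<inter> G)) \<longlonglongrightarrow> prob (\<Union>K. C N K \<inter> G)"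
        using incC[of N] by (intro finite_Lim_measure_incseq) (auto simp: incseq_def)
      then show ?thesis by (simp add: D_def)
    qed
    show "(\<lambda>K. (1 - \<delta>) * prob (C N K)) \<longlonglongrightarrow> (1 - \<delta>) * prob (D N)"
      unfolding D_def using incC by (intro tendsto_mult tendsto_const finite_Lim_measure_incseq) auto
    show "\<exists>N'. \<forall>K\<ge>N'. prob (C N K \<inter> G) \<le> (1 - \<delta>) * prob (C N K)"
      using ev[OF CF] by blast
  qed
  have "prob G \<le> (1 - \<delta>) * prob G"
  proof (rule LIMSEQ_le_const)
    have "(\<lambda>N. prob (D N)) \<longlonglongrightarrow> prob G"
      unfolding GD using decD by (intro finite_Lim_measure_decseq) auto
    then show "(\<lambda>N. (1 - \<delta>) * prob (D N)) \<longlonglongrightarrow> (1 - \<delta>) * prob G"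
      by (intro tendsto_mult tendsto_const)
    \<comment> \<open>Since \<open>G\<close> lies in every \<open>D N\<close>, the left side of
      \<open>Dev\<close> is constant and the bound survives the limit in \<open>N\<close>.\<close>
    have "D N \<inter> G = G" for N using GD by auto
    then show "\<exists>N. \<forall>n\<ge>N. prob G \<le> (1 - \<delta>) * prob (D n)"
      using Dev by auto
  qed
  then have "\<delta> * prob G \<le> 0" by (simp add: algebra_simps)
  then have "prob G = 0"
    using \<delta>(1) measure_nonneg[of M G] by (simp add: mult_le_0_iff)
  then show ?thesis
    unfolding G_def W_def[symmetric] using prob_compl[of W] by simp
qed

text \<open>Conditioning without conditional expectations: by independence the joint law of
  \<open>X\<close> and \<open>Y\<close> is the product law, so Tonelli integrates the section at
  \<open>X = x\<close> first, where the bound \<open>lower\<close> applies. The intended use has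
  \<open>X\<close> the identity into a sub-sigma-algebra.\<close>

lemma (in prob_space) indep_var_freeze:
  assumes X: "X \<in> M \<rightarrow>\<^sub>M S" and Y: "Y \<in> M \<rightarrow>\<^sub>M T"
    and ind: "\<And>A B. A \<in> sets S \<Longrightarrow> B \<in> sets T \<Longrightarrow>
      prob {\<omega> \<in> space M. X \<omega> \<in> A \<and> Y \<omega> \<in> B} = prob {\<omega> \<in> space M. X \<omega> \<in> A} * prob {\<omega> \<in> space M. Y \<omega> \<in> B}"
    and E: "E \<in> sets S" and P: "Measurable.pred (S \<Otimes>\<^sub>M T) P"
    and lower: "\<And>x. x \<in> E \<Longrightarrow> ennreal \<delta> \<le> emeasure (distr M T Y) {y \<in> space T. P (x, y)}"
    and \<delta>: "\<delta> \<ge> 0"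
  shows "\<delta> * prob {\<omega> \<in> space M. X \<omega> \<in> E} \<le> prob {\<omega> \<in> space M. X \<omega> \<in> E \<and> P (X \<omega>, Y \<omega>)}"
proof -
  note [measurable] = X Y E P
  interpret X: prob_space "distr M S X" by (rule prob_space_distr) simp
  interpret Y: prob_space "distr M T Y" by (rule prob_space_distr) simp
  have eq: "distr M S X \<Otimes>\<^sub>M distr M T Y = distr M (S \<Otimes>\<^sub>M T) (\<lambda>x. (X x, Y x))"
  proof (rule pair_measure_eqI)
    show "sigma_finite_measure (distr M S X)" "sigma_finite_measure (distr M T Y)" by unfold_locales
    show "sets (distr M S X \<Otimes>\<^sub>M distr M T Y) = sets (distr M (S \<Otimes>\<^sub>M T) (\<lambda>x. (X x, Y x)))"
      by (simp cong: sets_pair_measure_cong)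
    fix A B assume "A \<in> sets (distr M S X)" "B \<in> sets (distr M T Y)"
    then have [measurable]: "A \<in> sets S" "B \<in> sets T" by simp_all
    show "emeasure (distr M S X) A * emeasure (distr M T Y) B
        = emeasure (distr M (S \<Otimes>\<^sub>M T) (\<lambda>x. (X x, Y x))) (A \<times> B)"
      using ind[of A B]
      by (simp add: emeasure_distr emeasure_eq_measure ennreal_mult[symmetric] vimage_def Int_def conj_commute)
  qed
  define A where "A = {xy \<in> space (S \<Otimes>\<^sub>M T). fst xy \<in> E \<and> P xy}"
  have A [measurable]: "A \<in> sets (S \<Otimes>\<^sub>M T)" unfolding A_def by measurable
  have "ennreal (\<delta> * prob {\<omega> \<in> space M. X \<omega> \<in> E}) = ennreal \<delta> * emeasure (distr M S X) E"
    using \<delta> by (simp add: emeasure_distr emeasure_eq_measure ennreal_mult vimage_def Int_def conj_commute)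
  also have "\<dots> = (\<integral>\<^sup>+x. ennreal \<delta> * indicator E x \<partial>distr M S X)"
    by (simp add: nn_integral_cmult_indicator)
  also have "\<dots> \<le> (\<integral>\<^sup>+x. emeasure (distr M T Y) (Pair x -` A) \<partial>distr M S X)"
  proof (rule nn_integral_mono)
    fix x assume "x \<in> space (distr M S X)"
    then have "Pair x -` A = {y \<in> space T. P (x, y)}" if "x \<in> E"
      using that by (auto simp: A_def space_pair_measure)
    with lower show "ennreal \<delta> * indicator E x \<le> emeasure (distr M T Y) (Pair x -` A)"
      by (auto simp: indicator_def)
  qed
  also have "\<dots> = emeasure (distr M S X \<Otimes>\<^sub>M distr M T Y) A"
    by (rule Y.emeasure_pair_measure_alt[symmetric]) simp
  also have "\<dots> = ennreal (prob {\<omega> \<in> space M. X \<omega> \<in> E \<and> P (X \<omega>, Y \<omega>)})"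
    unfolding eq by (subst emeasure_distr)
      (auto simp: A_def emeasure_eq_measure space_pair_measure
        dest: measurable_space[OF X] measurable_space[OF Y]
        intro!: arg_cong[where f = prob])
  finally show ?thesis by simp
qed

primrec noise_chain :: "('x \<Rightarrow> 'z \<Rightarrow> 'x) \<Rightarrow> (nat \<Rightarrow> 'w \<Rightarrow> 'z) \<Rightarrow> 'x \<Rightarrow> nat \<Rightarrow> 'w \<Rightarrow> 'x" where
  "noise_chain S Z x 0 \<omega> = x"
| "noise_chain S Z x (Suc n) \<omega> = S (noise_chain S Z x n \<omega>) (Z n \<omega>)"

text \<open>The sigma-algebra generated by the noise strictly before time \<open>n\<close>: the
  state at time \<open>n\<close> is measurable here, while \<open>Z n\<close> still belongs to the
  future. As a pullback along the restricted tuple, each event comes with a set of the product space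
  that represents it.\<close>

definition past :: "'w measure \<Rightarrow> (nat \<Rightarrow> 'w \<Rightarrow> 'z::topological_space) \<Rightarrow> nat \<Rightarrow> 'w measure" where
  "past M Z n = vimage_algebra (space M) (\<lambda>\<omega>. \<lambda>i\<in>{..<n}. Z i \<omega>) (PiM {..<n} (\<lambda>_. borel))"

lemma space_past [simp]: "space (past M Z n) = space M"
  by (simp add: past_def)

lemma measurable_past_component: "i < n \<Longrightarrow> Z i \<in> past M Z n \<rightarrow>\<^sub>M borel"
proof -
  assume i: "i < n"
  have "(\<lambda>\<omega>. \<lambda>i\<in>{..<n}. Z i \<omega>) \<in> past M Z n \<rightarrow>\<^sub>M PiM {..<n} (\<lambda>_. borel)"
    unfolding past_def by (rule measurable_vimage_algebra1) (simp add: space_PiM)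
  from measurable_compose[OF this measurable_component_singleton[of i]] i
  show "Z i \<in> past M Z n \<rightarrow>\<^sub>M borel" by simp
qed

text \<open>Measurability of the identity expresses that \<open>past M Z n\<close> is coarser than
  \<open>N\<close>; it yields the inclusion of sigma-algebras and is the form in which the whole
  past can be frozen.\<close>

lemma measurable_ident_past:
  assumes "\<And>i. i < n \<Longrightarrow> Z i \<in> N \<rightarrow>\<^sub>M borel" "space N = space M"
  shows "(\<lambda>\<omega>. \<omega>) \<in> N \<rightarrow>\<^sub>M past M Z n"
  unfolding past_def using assms
  by (intro measurable_vimage_algebra2 measurable_restrict) auto

lemma sets_past_subset:
  assumes "\<And>i. i < n \<Longrightarrow> Z i \<in> N \<rightarrow>\<^sub>M borel" "space N = space M"
  shows "sets (past M Z n) \<subseteq> sets N"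
proof
  fix E assume E: "E \<in> sets (past M Z n)"
  from measurable_sets[OF measurable_ident_past[OF assms] E] sets.sets_into_space[OF E] assms(2)
  show "E \<in> sets N" by (simp add: Int_absorb2)
qed

lemma sets_past_mono: "m \<le> n \<Longrightarrow> sets (past M Z m) \<subseteq> sets (past M Z n)"
  by (rule sets_past_subset) (simp_all add: measurable_past_component)

text \<open>The blocks over the disjoint index sets \<open>{..<n}\<close> and \<open>{n..}\<close>
  are independent, and each event of the past is a preimage under the first block.\<close>

lemma (in prob_space) indep_past_future:
  assumes "indep_vars (\<lambda>_. borel) Z UNIV"
    and E: "E \<in> sets (past M Z n)" and U: "U \<in> sets (PiM {n..} (\<lambda>_. borel))"
  shows "prob (E \<inter> ((\<lambda>\<omega>. \<lambda>i\<in>{n..}. Z i \<omega>) -` U \<inter> space M))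
    = prob E * prob ((\<lambda>\<omega>. \<lambda>i\<in>{n..}. Z i \<omega>) -` U \<inter> space M)"
proof -
  let ?X = "\<lambda>\<omega>. \<lambda>i\<in>{..<n}. Z i \<omega>" and ?Y = "\<lambda>\<omega>. \<lambda>i\<in>{n..}. Z i \<omega>"
  have ind: "indep_var (PiM {..<n} (\<lambda>_. borel)) ?X (PiM {n..} (\<lambda>_. borel)) ?Y"
    by (rule indep_var_restrict[OF assms(1)]) auto
  have "?X \<in> space M \<rightarrow> space (PiM {..<n} (\<lambda>_. borel))"
    by (simp add: space_PiM)
  then obtain A where A: "A \<in> sets (PiM {..<n} (\<lambda>_. borel))" "E = ?X -` A \<inter> space M"
    using E unfolding past_def by (subst (asm) sets_vimage_algebra2) auto
  have "(\<lambda>\<omega>. (?X \<omega>, ?Y \<omega>)) -` (A \<times> U) \<inter> space M = E \<inter> (?Y -` U \<inter> space M)"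
    using A(2) by auto
  with indep_varD[OF ind A(1) U] A(2) show ?thesis by simp
qed

lemma measurable_noise_chain:
  assumes S: "(\<lambda>(x, z). S x z) \<in> borel \<Otimes>\<^sub>M borel \<rightarrow>\<^sub>M borel"
  shows "noise_chain S Z x n \<in> past M Z n \<rightarrow>\<^sub>M borel"
proof (induction n)
  case 0
  show ?case by (simp cong: measurable_cong)
next
  case (Suc n)
  have "noise_chain S Z x n \<in> past M Z (Suc n) \<rightarrow>\<^sub>M borel"
    using Suc measurable_mono[of borel borel "past M Z n" "past M Z (Suc n)"] sets_past_mono[of n "Suc n" M Z]
    by auto
  moreover have "Z n \<in> past M Z (Suc n) \<rightarrow>\<^sub>M borel"
    by (rule measurable_past_component) simp
  ultimately have "(\<lambda>\<omega>. (noise_chain S Z x n \<omega>, Z n \<omega>)) \<in> past M Z (Suc n) \<rightarrow>\<^sub>M borel \<Otimes>\<^sub>M borel"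
    by (rule measurable_Pair)
  from measurable_compose[OF this S] show ?case by simp
qed

text \<open>\<open>V k\<close> is the noise allowed at step \<open>k\<close> of a run and
  \<open>a k\<close> the distance allowed then. Within any past event a run succeeds on a fixed
  share of its probability: \<open>q\<close> if it starts within \<open>a 0\<close>, and
  \<open>q * \<delta>\<close> if one step is first spent on entering.
  \<open>prob_liminf_eq_1\<close> turns this into probability 1.\<close>

lemma (in prob_space) noise_chain_eventually_captured:
  fixes S :: "'x::topological_space \<Rightarrow> 'z::topological_space \<Rightarrow> 'x" and d :: "'x \<Rightarrow> real" and a :: "nat \<Rightarrow> real"
  assumes S: "(\<lambda>(x, z). S x z) \<in> borel \<Otimes>\<^sub>M borel \<rightarrow>\<^sub>M borel"
    and d: "d \<in> borel_measurable borel"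
    and indep: "indep_vars (\<lambda>_. borel) Z UNIV"
    and law: "\<And>n. distr M borel (Z n) = \<mu>"
    and V: "\<And>k. V k \<in> sets borel"
    and confined: "\<And>n. q \<le> prob {\<omega> \<in> space M. \<forall>k. Z (n + k) \<omega> \<in> V k}" "q > 0"
    and follow: "\<And>k x z. d x \<le> a k \<Longrightarrow> z \<in> V k \<Longrightarrow> d (S x z) \<le> a (Suc k)"
    and hit: "\<And>x. d x > a 0 \<Longrightarrow> ennreal \<delta> \<le> emeasure \<mu> {z. d (S x z) \<le> a 0}" "\<delta> > 0"
  shows "AE \<omega> in M. \<exists>n. \<forall>k. d (noise_chain S Z x (n + k) \<omega>) \<le> a k"
proof -
  define Y where "Y = noise_chain S Z x"
  define F where "F = past M Z"
  have Zm [measurable]: "Z i \<in> M \<rightarrow>\<^sub>M borel" for i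
    using indep by (simp add: indep_vars_def)
  note [measurable] = S d V
  have Y [measurable]: "Y n \<in> F n \<rightarrow>\<^sub>M borel" for n
    unfolding Y_def F_def by (rule measurable_noise_chain[OF S])
  have F: "sets (F n) \<subseteq> events" "space (F n) = space M" for n
    unfolding F_def by (simp_all add: sets_past_subset)
  have mono: "sets (F i) \<subseteq> sets (F j)" if "i \<le> j" for i j
    unfolding F_def using that by (rule sets_past_mono)
  have q0: "0 \<le> q" using confined by simp
  define B where "B n k = {\<omega> \<in> space M. d (Y (n + k) \<omega>) \<le> a k}" for n k
  have B: "B n k \<in> sets (F (n + k))" for n k
    unfolding B_def F(2)[of "n + k", symmetric] by measurable
  then have BM [measurable]: "B n k \<in> events" for n k using F by blast
  define W where "W = (\<Union>n. \<Inter>k. B n k)"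
  have WM [measurable]: "W \<in> events" unfolding W_def by measurable
  have inside: "q * prob E \<le> prob (E \<inter> W)"
    if E: "E \<in> sets (F n)" and sub: "\<And>\<omega>. \<omega> \<in> E \<Longrightarrow> d (Y n \<omega>) \<le> a 0" for E n
  proof -
    have EM: "E \<in> events" using E F by blast
    define U where "U = {z \<in> space (PiM {n..} (\<lambda>_. borel)). \<forall>k. z (n + k) \<in> V k}"
    have U: "U \<in> sets (PiM {n..} (\<lambda>_. borel))" unfolding U_def by measurable
    \<comment> \<open>This event involves the noise from time \<open>n\<close> onwards and so is
      independent of \<open>E\<close>; on it the schedule is followed deterministically.\<close>
    define conf where "conf = {\<omega> \<in> space M. \<forall>k. Z (n + k) \<omega> \<in> V k}"
    have [measurable]: "conf \<in> events" unfolding conf_def by measurable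
    have "prob (E \<inter> ((\<lambda>\<omega>. \<lambda>i\<in>{n..}. Z i \<omega>) -` U \<inter> space M))
        = prob E * prob ((\<lambda>\<omega>. \<lambda>i\<in>{n..}. Z i \<omega>) -` U \<inter> space M)"
      using E U by (intro indep_past_future[OF indep]) (simp_all add: F_def)
    moreover have "(\<lambda>\<omega>. \<lambda>i\<in>{n..}. Z i \<omega>) -` U \<inter> space M = conf"
      by (auto simp: U_def conf_def space_PiM)
    ultimately have "prob (E \<inter> conf) = prob E * prob conf" by simp
    moreover have "q * prob E \<le> prob E * prob conf"
      unfolding conf_def using confined(1)[of n] by (subst mult.commute) (intro mult_left_mono, auto)
    moreover have "E \<inter> conf \<subseteq> E \<inter> W"
    proof safe
      fix \<omega> assume \<omega>: "\<omega> \<in> E" "\<omega> \<in> conf"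
      have "d (Y (n + k) \<omega>) \<le> a k" for k
      proof (induction k)
        case (Suc k)
        then show ?case
          using follow[of "Y (n + k) \<omega>" k "Z (n + k) \<omega>"] \<omega>(2) by (simp add: Y_def conf_def)
      qed (use sub \<omega>(1) in simp)
      then show "\<omega> \<in> W"
        using \<omega>(2) by (auto simp: W_def B_def conf_def)
    qed
    ultimately show ?thesis
      using finite_measure_mono[of "E \<inter> conf" "E \<inter> W"] EM by auto
  qed
  have outside: "q * \<delta> * prob E \<le> prob (E \<inter> W)"
    if E: "E \<in> sets (F n)" and sub: "\<And>\<omega>. \<omega> \<in> E \<Longrightarrow> d (Y n \<omega>) > a 0" for E n
  proof -
    have EM: "E \<in> events" using E F by blast
    have ind: "prob {\<omega> \<in> space M. \<omega> \<in> A \<and> Z n \<omega> \<in> C} = prob {\<omega> \<in> space M. \<omega> \<in> A} * prob {\<omega> \<in> space M. Z n \<omega> \<in> C}"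
      if A: "A \<in> sets (F n)" and C [measurable]: "C \<in> sets borel" for A C
    proof -
      define U where "U = {z \<in> space (PiM {n..} (\<lambda>_. borel)). z n \<in> C}"
      have "U \<in> sets (PiM {n..} (\<lambda>_. borel))" unfolding U_def by measurable
      from indep_past_future[OF indep A[unfolded F_def] this]
      have "prob (A \<inter> {\<omega> \<in> space M. Z n \<omega> \<in> C}) = prob A * prob {\<omega> \<in> space M. Z n \<omega> \<in> C}"
        by (simp add: U_def vimage_def space_PiM Int_def conj_commute)
      moreover have "A \<subseteq> space M" using sets.sets_into_space[OF A] F by simp
      ultimately show ?thesis
        by (simp add: Int_def subset_eq conj_commute cong: conj_cong) (metis (no_types, lifting) Collect_mem_eq Collect_cong)
    qed
    define E' where "E' = {\<omega> \<in> space M. \<omega> \<in> E \<and> d (S (Y n \<omega>) (Z n \<omega>)) \<le> a 0}"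
    have "\<delta> * prob {\<omega> \<in> space M. \<omega> \<in> E}
        \<le> prob {\<omega> \<in> space M. \<omega> \<in> E \<and> (\<lambda>(\<omega>, z). d (S (Y n \<omega>) z) \<le> a 0) (\<omega>, Z n \<omega>)}"
    proof (rule indep_var_freeze[where S = "F n" and T = borel and X = "\<lambda>\<omega>. \<omega>" and Y = "Z n", OF _ _ ind E])
      show "(\<lambda>\<omega>. \<omega>) \<in> M \<rightarrow>\<^sub>M F n"
        unfolding F_def by (rule measurable_ident_past) simp_all
      show "Measurable.pred (F n \<Otimes>\<^sub>M borel) (\<lambda>(\<omega>, z). d (S (Y n \<omega>) z) \<le> a 0)"
        by measurable
      show "ennreal \<delta> \<le> emeasure (distr M borel (Z n))
          {z \<in> space borel. (\<lambda>(\<omega>, z). d (S (Y n \<omega>) z) \<le> a 0) (\<omega>, z)}" if "\<omega> \<in> E" for \<omega>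
        unfolding law using hit(1) sub[OF that] by simp
    qed (use hit(2) in simp_all)
    then have "\<delta> * prob {\<omega> \<in> space M. \<omega> \<in> E} \<le> prob E'"
      by (simp add: E'_def)
    moreover have "{\<omega> \<in> space M. \<omega> \<in> E} = E" using sets.sets_into_space[OF EM] by auto
    moreover have "q * prob E' \<le> prob (E' \<inter> W)"
    \<comment> \<open>After entering, the run starts afresh one step later; \<open>E'\<close>
      depends on \<open>Z n\<close> and so belongs to the past of time \<open>Suc n\<close>.\<close>
    proof (rule inside[of _ "Suc n"])
      have "E \<in> sets (F (Suc n))" using E mono[of n "Suc n"] by auto
      moreover have "E' = {\<omega> \<in> space (F (Suc n)). \<omega> \<in> E \<and> d (Y (Suc n) \<omega>) \<le> a 0}"
        by (auto simp: E'_def F Y_def)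
      ultimately show "E' \<in> sets (F (Suc n))" by simp
    qed (simp add: E'_def Y_def)
    moreover have "prob (E' \<inter> W) \<le> prob (E \<inter> W)"
      using EM by (intro finite_measure_mono) (auto simp: E'_def)
    ultimately have "q * (\<delta> * prob E) \<le> prob (E \<inter> W)"
      using q0 by (metis mult_left_mono order_trans)
    then show ?thesis by (simp add: mult.assoc)
  qed
  have "prob W = 1"
    unfolding W_def
  proof (rule prob_liminf_eq_1[where F = F and B = B, OF F mono B])
    \<comment> \<open>The minimum is taken because \<open>\<delta>\<close> may exceed 1 when no
      state has \<open>d x > a 0\<close>.\<close>
    show "min q (q * \<delta>) > 0" using confined(2) hit(2) by simp
    fix n E assume E: "E \<in> sets (F n)"
    have EM: "E \<in> events" using E F by blast
    define E1 where "E1 = {\<omega> \<in> space (F n). \<omega> \<in> E \<and> d (Y n \<omega>) \<le> a 0}"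
    define E2 where "E2 = {\<omega> \<in> space (F n). \<omega> \<in> E \<and> d (Y n \<omega>) > a 0}"
    have E12: "E1 \<in> sets (F n)" "E2 \<in> sets (F n)"
      unfolding E1_def E2_def using E by measurable
    then have [measurable]: "E1 \<in> events" "E2 \<in> events" using F by blast+
    have un: "E = E1 \<union> E2" "E \<inter> W = (E1 \<inter> W) \<union> (E2 \<inter> W)" "E1 \<inter> E2 = {}"
      using sets.sets_into_space[OF E] by (auto simp: E1_def E2_def)
    have "prob E = prob E1 + prob E2"
      unfolding un(1) using un(3) by (intro finite_measure_Union) auto
    moreover have "prob (E \<inter> W) = prob (E1 \<inter> W) + prob (E2 \<inter> W)"
      unfolding un(2) using un(3) by (intro finite_measure_Union) auto
    moreover have "min q (q * \<delta>) * prob E1 \<le> prob (E1 \<inter> W)"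
      by (rule order_trans[OF mult_right_mono inside[OF E12(1)]]) (auto simp: E1_def)
    moreover have "min q (q * \<delta>) * prob E2 \<le> prob (E2 \<inter> W)"
      by (rule order_trans[OF mult_right_mono outside[OF E12(2)]]) (auto simp: E2_def)
    ultimately show "min q (q * \<delta>) * prob E \<le> prob (E \<inter> (\<Union>n. \<Inter>k. B n k))"
      by (simp add: W_def[symmetric] distrib_left)
  qed
  then have "AE \<omega> in M. \<omega> \<in> W"
    using prob_eq_1[OF WM] by simp
  then show ?thesis
    by eventually_elim (auto simp: W_def B_def Y_def)
qed

section \<open>Convergence of the noisy Newton iteration\<close>

lemma to_torus_noise_chain:
  "to_torus (noise_chain (lift_step (f \<circ> to_torus) \<alpha>) Z x n \<omega>) = noisy_newton f \<alpha> Z (to_torus x) n \<omega>"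
  by (induction n) (simp_all add: to_torus_lift_step del: comp_apply)

lemma to_torus_add_lattice: "k \<in> int_lattice \<Longrightarrow> to_torus (x + k) = to_torus x"
  by (simp add: to_torus_eq_iff)

lemma continuous_on_to_torus: "continuous_on A to_torus"
  unfolding continuous_on_iff using dist_to_torus_le le_less_trans by blast

text \<open>Rounding down each coordinate of \<open>x - p\<close> leaves fractional parts; a crude
  estimate by the sum of coordinates suffices, as the bound only has to be uniform in
  \<open>x\<close>.\<close>

lemma lattice_translate_near:
  obtains k where "k \<in> int_lattice" "norm (x + k - p :: real ^ 'n::finite) \<le> real CARD('n)"
proof
  let ?k = "\<chi> i. - of_int \<lfloor>x $ i - p $ i\<rfloor> :: real ^ 'n"
  show "?k \<in> int_lattice" by (simp add: int_lattice_def)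
  have "norm (x + ?k - p) \<le> (\<Sum>i\<in>UNIV. \<bar>(x + ?k - p) $ i\<bar>)"
    by (rule norm_le_l1_cart)
  also have "\<dots> \<le> (\<Sum>i\<in>(UNIV :: 'n set). 1)"
  proof (rule sum_mono)
    fix i
    have "(x + ?k - p) $ i = frac (x $ i - p $ i)" by (simp add: frac_def)
    then show "\<bar>(x + ?k - p) $ i\<bar> \<le> 1"
      using frac_lt_1[of "x $ i - p $ i"] frac_ge_0[of "x $ i - p $ i"] by linarith
  qed
  finally show "norm (x + ?k - p) \<le> real CARD('n)" by simp
qed

text \<open>Compactness of the torus in disguise: every point has a representative in the ball of
  radius \<open>D\<close> about 0, so the far points are covered by a compact set on which the
  continuous lift attains its extrema, and the minimum is positive.\<close>

lemma torus_bounds_away_from_zero_set: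
  fixes f :: "'n::finite torus \<Rightarrow> real"
  assumes cont: "continuous_on UNIV (f \<circ> to_torus)"
    and pos: "\<And>x. x \<noteq> c \<Longrightarrow> f x > 0" and r: "r > 0"
  obtains l u where "l > 0" "\<And>x. dist x c > r \<Longrightarrow> l \<le> f x \<and> f x \<le> u"
proof -
  define D where "D = real CARD('n)"
  define K :: "(real ^ 'n) set" where "K = cball 0 D \<inter> {x. r \<le> dist (to_torus x) c}"
  have "closed {x :: real ^ 'n. r \<le> dist (to_torus x) c}"
    by (intro closed_Collect_le continuous_on_const continuous_on_dist continuous_on_to_torus)
  then have K: "compact K"
    unfolding K_def by (rule compact_Int_closed[OF compact_cball])
  have rep: "\<exists>y\<in>K. to_torus y = x" if "dist x c > r" for x
  proof -
    obtain k where k: "k \<in> int_lattice" "norm (torus_rep x + k - 0) \<le> D"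
      unfolding D_def by (rule lattice_translate_near)
    with that show ?thesis
      by (intro bexI[of _ "torus_rep x + k"]) (auto simp: K_def to_torus_add_lattice)
  qed
  have contK: "continuous_on K (f \<circ> to_torus)" using cont by (rule continuous_on_subset) simp
  show thesis
  proof (cases "K = {}")
    case True
    then show thesis using rep that[of 1 1] by fastforce
  next
    case False
    obtain y where y: "y \<in> K" "\<And>x. x \<in> K \<Longrightarrow> f (to_torus y) \<le> f (to_torus x)"
      using continuous_attains_inf[OF K False contK] by auto
    obtain z where z: "z \<in> K" "\<And>x. x \<in> K \<Longrightarrow> f (to_torus x) \<le> f (to_torus z)"
      using continuous_attains_sup[OF K False contK] by auto
    have "f (to_torus y) > 0" using y(1) r by (intro pos) (auto simp: K_def)
    moreover have "f (to_torus y) \<le> f x \<and> f x \<le> f (to_torus z)" if "dist x c > r" for x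
      using rep[OF that] y z by blast
    ultimately show thesis by (rule that)
  qed
qed

text \<open>The Newton point \<open>y\<close> may be arbitrarily far away, but a lattice translate
  of it is within \<open>D\<close> of \<open>p\<close>. The noise then has to correct a bounded
  displacement, with amplitude between two positive bounds, so the Gaussian mass of the required
  ball is bounded below.\<close>

lemma lift_step_hits_ball:
  fixes f :: "'n::finite torus \<Rightarrow> real"
  assumes cont: "continuous_on UNIV (f \<circ> to_torus)"
    and pos: "\<And>x. x \<noteq> to_torus p \<Longrightarrow> f x > 0" and r: "r > 0" and \<alpha>: "\<alpha> > 0"
  obtains \<delta> where "\<delta> > 0"
    "\<And>x. dist (to_torus x) (to_torus p) > r \<Longrightarrow>
      ennreal \<delta> \<le> emeasure gauss {z. dist (to_torus (lift_step (f \<circ> to_torus) \<alpha> x z)) (to_torus p) \<le> r}"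
proof -
  obtain l u where lu: "l > 0" "\<And>x. dist x (to_torus p) > r \<Longrightarrow> l \<le> f x \<and> f x \<le> u"
    using torus_bounds_away_from_zero_set[OF cont pos r] by blast
  define D where "D = real CARD('n)"
  \<comment> \<open>The maximum with \<open>l\<close> keeps \<open>w\<close> positive even if
    \<open>u\<close> is not, which can happen when no point is far from the minimizer.\<close>
  define w where "w = max l u powr \<alpha>"
  have w: "w > 0" using lu(1) by (simp add: w_def)
  obtain \<delta> where \<delta>: "\<delta> > 0"
    "\<And>c :: real ^ 'n. norm c \<le> D / (l powr \<alpha>) \<Longrightarrow> ennreal \<delta> \<le> emeasure gauss (cball c (r / w))"
    using gauss_cball_lower_bound[of "r / w" "D / (l powr \<alpha>)"] r w by auto
  have "ennreal \<delta> \<le> emeasure gauss {z. dist (to_torus (lift_step (f \<circ> to_torus) \<alpha> x z)) (to_torus p) \<le> r}"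
    if x: "dist (to_torus x) (to_torus p) > r" for x
  proof -
    define \<sigma> where "\<sigma> = f (to_torus x) powr \<alpha>"
    define y where "y = lift_step (f \<circ> to_torus) \<alpha> x 0"
    have step: "lift_step (f \<circ> to_torus) \<alpha> x z = y + \<sigma> *\<^sub>R z" for z
      by (simp add: lift_step_def y_def \<sigma>_def)
    have fx: "l \<le> f (to_torus x)" "f (to_torus x) \<le> u" using lu(2)[OF x] by auto
    then have \<sigma>: "l powr \<alpha> \<le> \<sigma>" "\<sigma> \<le> w"
      using lu(1) \<alpha> unfolding \<sigma>_def w_def by (auto intro!: powr_mono2)
    have l\<alpha>: "l powr \<alpha> > 0" using lu(1) by simp
    then have \<sigma>0: "\<sigma> > 0" using \<sigma>(1) by linarith
    obtain k where k: "k \<in> int_lattice" "norm (y + k - p) \<le> D"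
      unfolding D_def by (rule lattice_translate_near)
    \<comment> \<open>The noise value that lands exactly on \<open>p\<close> modulo the lattice; an
      error of \<open>r / w\<close> in it is magnified by \<open>\<sigma> \<le> w\<close> to at most
      \<open>r\<close>.\<close>
    define c where "c = (1 / \<sigma>) *\<^sub>R (p - (y + k))"
    have "norm c = norm (y + k - p) / \<sigma>"
      using \<sigma>0 by (simp add: c_def norm_minus_commute)
    also have "\<dots> \<le> D / (l powr \<alpha>)"
      using k(2) \<sigma>(1) l\<alpha> by (intro frac_le) (auto simp: D_def)
    finally have "ennreal \<delta> \<le> emeasure gauss (cball c (r / w))" by (rule \<delta>(2))
    also have "\<dots> \<le> emeasure gauss {z. dist (to_torus (lift_step (f \<circ> to_torus) \<alpha> x z)) (to_torus p) \<le> r}"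
    proof (rule emeasure_mono)
      show "cball c (r / w) \<subseteq> {z. dist (to_torus (lift_step (f \<circ> to_torus) \<alpha> x z)) (to_torus p) \<le> r}"
      proof
        fix z assume "z \<in> cball c (r / w)"
        then have z: "norm (z - c) \<le> r / w" by (simp add: dist_norm norm_minus_commute)
        have "to_torus (lift_step (f \<circ> to_torus) \<alpha> x z) = to_torus (y + \<sigma> *\<^sub>R z + k)"
          by (simp add: step to_torus_add_lattice k(1))
        then have "dist (to_torus (lift_step (f \<circ> to_torus) \<alpha> x z)) (to_torus p) \<le> norm (y + \<sigma> *\<^sub>R z + k - p)"
          using dist_to_torus_le[of "y + \<sigma> *\<^sub>R z + k" p] by (simp add: dist_norm)
        also have "y + \<sigma> *\<^sub>R z + k - p = \<sigma> *\<^sub>R (z - c)"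
          using \<sigma>0 by (simp add: c_def algebra_simps)
        also have "norm (\<sigma> *\<^sub>R (z - c)) = \<sigma> * norm (z - c)" using \<sigma>0 by simp
        also have "\<dots> \<le> w * (r / w)"
          using \<sigma> \<sigma>0 z by (intro mult_mono) auto
        also have "\<dots> = r" using w by simp
        finally show "z \<in> {z. dist (to_torus (lift_step (f \<circ> to_torus) \<alpha> x z)) (to_torus p) \<le> r}"
          unfolding mem_Collect_eq .
      qed
      have "continuous_on UNIV (\<lambda>z. dist (to_torus (y + \<sigma> *\<^sub>R z)) (to_torus p))"
        by (intro continuous_on_dist continuous_on_const
            continuous_on_compose2[OF continuous_on_to_torus[of UNIV]] continuous_intros) auto
      then have "closed {z. dist (to_torus (y + \<sigma> *\<^sub>R z)) (to_torus p) \<le> r}"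
        by (intro closed_Collect_le continuous_on_const)
      then show "{z. dist (to_torus (lift_step (f \<circ> to_torus) \<alpha> x z)) (to_torus p) \<le> r} \<in> sets gauss"
        by (simp add: step sets_gauss)
    qed
    finally show ?thesis .
  qed
  with \<delta>(1) show thesis by (rule that)
qed

text \<open>Budget for one step: the Newton error \<open>N\<close> takes
  \<open>(Q - 1) * a\<^sup>2\<close> and the noise the remaining \<open>a\<^sup>2\<close>. Since
  \<open>g\<close> is at most quadratic in the distance, the amplitude is at most a constant times
  \<open>a\<^sup>2 * a powr \<beta>\<close>, with \<open>\<beta> = 2 * \<alpha> - 2 > 0\<close>; as
  \<open>a \<le> r / 2 ^ k\<close>, the surplus factor decays just fast enough to cancel the allowed
  growth of \<open>z\<close>.\<close>

lemma noisy_step_contraction: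
  fixes a r Q C \<alpha> T N g v :: real
  assumes newton: "N \<le> (Q - 1) * v\<^sup>2" and "Q \<ge> 1"
    and g: "0 \<le> g" "g \<le> C * v\<^sup>2" and v: "0 \<le> v" "v \<le> a" and a: "0 < a" "a \<le> r / 2 ^ k" and "C > 0"
    and z: "0 \<le> z" "z \<le> T / (2 powr - (2 * \<alpha> - 2)) ^ k"
    and \<alpha>: "\<alpha> > 1" and small: "C powr \<alpha> * r powr (2 * \<alpha> - 2) * T \<le> 1"
  shows "N + g powr \<alpha> * z \<le> Q * a\<^sup>2"
proof -
  define \<beta> where "\<beta> = 2 * \<alpha> - 2"
  have \<beta>: "\<beta> > 0" using \<alpha> by (simp add: \<beta>_def)
  have "0 < r / 2 ^ k" using a by linarith
  then have r: "r > 0" by (simp add: zero_less_divide_iff)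
  have sk: "(2 powr - (2 * \<alpha> - 2)) ^ k > 0" by simp
  have "T / (2 powr - (2 * \<alpha> - 2)) ^ k \<ge> 0" using z by linarith
  then have T: "T \<ge> 0" using sk by (simp only: zero_le_divide_iff) linarith
  have va: "v\<^sup>2 \<le> a\<^sup>2" using v by (intro power_mono) auto
  have "N \<le> (Q - 1) * a\<^sup>2"
    using newton va \<open>Q \<ge> 1\<close> mult_left_mono[of "v\<^sup>2" "a\<^sup>2" "Q - 1"] by linarith
  moreover have "g powr \<alpha> * z \<le> a\<^sup>2"
  proof -
    have "g \<le> C * a\<^sup>2"
      using g(2) va \<open>C > 0\<close> mult_left_mono[of "v\<^sup>2" "a\<^sup>2" C] by linarith
    then have "g powr \<alpha> \<le> (C * a\<^sup>2) powr \<alpha>"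
      using g \<alpha> by (intro powr_mono2) auto
    also have "\<dots> = C powr \<alpha> * a powr (2 * \<alpha>)"
    proof -
      have "a\<^sup>2 = a powr 2" using a by simp
      then have "(a\<^sup>2) powr \<alpha> = a powr (2 * \<alpha>)" by (simp only: powr_powr)
      then show ?thesis using \<open>C > 0\<close> by (simp add: powr_mult)
    qed
    also have "a powr (2 * \<alpha>) = a\<^sup>2 * a powr \<beta>"
    proof -
      have "a powr (2 * \<alpha>) = a powr (2 + \<beta>)" by (simp add: \<beta>_def)
      also have "\<dots> = a powr 2 * a powr \<beta>" by (rule powr_add)
      finally show ?thesis using a by simp
    qed
    finally have 1: "g powr \<alpha> \<le> C powr \<alpha> * (a\<^sup>2 * a powr \<beta>)" .
    have "a powr \<beta> \<le> (r / 2 ^ k) powr \<beta>"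
      using a \<beta> by (intro powr_mono2) auto
    also have "\<dots> = r powr \<beta> * (2 powr - \<beta>) ^ k"
    proof -
      have "(2 ^ k :: real) powr \<beta> * (2 powr - \<beta>) ^ k = 2 powr (real k * \<beta>) * 2 powr (- \<beta> * real k)"
        by (simp add: powr_powr powr_power flip: powr_realpow)
      also have "\<dots> = 1"
        by (simp add: mult.commute flip: powr_add)
      finally have "(2 powr - \<beta>) ^ k = 1 / (2 ^ k :: real) powr \<beta>"
        by (simp add: eq_divide_eq mult.commute)
      then show ?thesis using r by (simp add: powr_divide)
    qed
    finally have 2: "a powr \<beta> \<le> r powr \<beta> * (2 powr - \<beta>) ^ k" .
    have "g powr \<alpha> * z \<le> (C powr \<alpha> * (a\<^sup>2 * (r powr \<beta> * (2 powr - \<beta>) ^ k))) * (T / (2 powr - \<beta>) ^ k)"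
      using z 2 T by (intro mult_mono order_trans[OF 1] mult_left_mono) (auto simp: \<beta>_def)
    also have "\<dots> = a\<^sup>2 * (C powr \<alpha> * r powr \<beta> * T)"
      by simp
    also have "\<dots> \<le> a\<^sup>2 * 1"
      using small by (intro mult_left_mono) (auto simp: \<beta>_def)
    finally show ?thesis by simp
  qed
  ultimately show ?thesis by (simp add: algebra_simps)
qed

text \<open>As \<open>Q * a k \<le> 1 / 2\<close>, each step at least halves. This geometric decay
  is what absorbs the geometrically growing noise.\<close>

lemma quadratic_schedule_bounds:
  fixes a :: "nat \<Rightarrow> real"
  assumes "a 0 = r" "\<And>k. a (Suc k) = Q * (a k)\<^sup>2" "r > 0" "Q > 0" "Q * r \<le> 1 / 2"
  shows "0 < a k \<and> a k \<le> r / 2 ^ k"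
proof (induction k)
  case 0
  then show ?case using assms by simp
next
  case (Suc k)
  have "r / 2 ^ k \<le> r" using assms(3) by (simp add: divide_le_eq mult_le_cancel_left1)
  then have "Q * a k \<le> Q * r" using Suc assms(4) by (intro mult_left_mono) auto
  then have "Q * a k \<le> 1 / 2" using assms(5) by linarith
  then have "Q * a k * a k \<le> 1 / 2 * (r / 2 ^ k)"
    using Suc assms by (intro mult_mono) auto
  then show ?case using Suc assms by (simp add: power2_eq_square mult.assoc)
qed

theorem theorem2p1:
  fixes f :: "'n::finite torus \<Rightarrow> real"
    and xstar :: "'n torus"
    and p :: "real ^ 'n"
    and r\<^sub>0 m L \<alpha> :: real
    and M :: "'w measure"
    and Z :: "nat \<Rightarrow> 'w \<Rightarrow> real ^ 'n"
  assumes C2: "torus_C2 f"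
    and unique_minimizer: "\<And>x. is_arg_min f (\<lambda>_. True) x \<longleftrightarrow> x = xstar"
    and min_value: "f xstar = 0"
    and constants: "r\<^sub>0 > 0" "m > 0" "L > 0"
    and chart_centre: "to_torus p = xstar"
    and chart: "inj_on to_torus (ball p r\<^sub>0)"
    and convex: "\<And>x. x \<in> ball p r\<^sub>0 \<Longrightarrow> mat m \<preceq> torus_hessian f (to_torus x)"
    and lipschitz: "\<And>x y. x \<in> ball p r\<^sub>0 \<Longrightarrow> y \<in> ball p r\<^sub>0 \<Longrightarrow>
          onorm ((*v) (torus_hessian f (to_torus x) - torus_hessian f (to_torus y)))
            \<le> L * norm (x - y)"
    and alpha: "\<alpha> > 1"
    and prob: "prob_space M"
    and gaussian: "\<And>n. std_gaussian_vector M (Z n)"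
    and indep: "prob_space.indep_vars M (\<lambda>_. borel) Z UNIV"
  shows "(\<forall>x\<^sub>0. AE \<omega> in M. (\<lambda>n. noisy_newton f \<alpha> Z x\<^sub>0 n \<omega>) \<longlonglongrightarrow> xstar) \<and>
    (\<exists>r Q a. 0 < r \<and> r < r\<^sub>0 \<and> Q > L / (2 * m) \<and> Q * r < 1 \<and>
       a 0 = r \<and> (\<forall>k. a (Suc k) = Q * (a k)\<^sup>2) \<and>
       (\<forall>x\<^sub>0. AE \<omega> in M. \<exists>N. \<forall>k. \<exists>y\<in>ball p r\<^sub>0.
          to_torus y = noisy_newton f \<alpha> Z x\<^sub>0 (N + k) \<omega> \<and> norm (y - p) \<le> a k))"
proof -
  interpret prob_space M by (rule prob)

  \<comment> \<open>The minimizer in Euclidean coordinates\<close>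
  define g where "g = f \<circ> to_torus"
  have g: "C2 g" using C2 by (simp add: torus_C2_def g_def)
  have min: "f xstar \<le> f x" for x
    using unique_minimizer[of xstar] by (auto simp: is_arg_min_def not_less)
  have pos: "f x > 0" if ne: "x \<noteq> xstar" for x
  proof -
    obtain y where "f y < f x"
      using unique_minimizer[of x] ne unfolding is_arg_min_def by blast
    then show ?thesis using min[of y] min_value by simp
  qed
  have nonneg: "g x \<ge> 0" for x using min[of "to_torus x"] min_value by (simp add: g_def)
  have gp: "g p = 0" using min_value chart_centre by (simp add: g_def)
  have crit: "gradient g p = 0"
  proof -
    have "(g has_derivative (\<lambda>h. gradient g p \<bullet> h)) (at p)"
      using g by (simp add: C2_def has_derivative_gradient)
    then have "(\<lambda>h. gradient g p \<bullet> h) = (\<lambda>h. 0)"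
      by (rule has_derivative_local_min) (simp add: gp nonneg)
    from fun_cong[OF this, of "gradient g p"] show ?thesis by simp
  qed
  have convex': "mat m \<preceq> hessian g x" if "x \<in> ball p r\<^sub>0" for x
    using convex[OF that] by (simp add: torus_hessian_to_torus g_def)
  have lip': "onorm ((*v) (hessian g x - hessian g y)) \<le> L * norm (x - y)"
    if "x \<in> ball p r\<^sub>0" "y \<in> ball p r\<^sub>0" for x y
    using lipschitz[OF that] by (simp add: torus_hessian_to_torus g_def)

  \<comment> \<open>Choice of the constants\<close>
  define \<beta> where "\<beta> = 2 * \<alpha> - 2"
  \<comment> \<open>When the distance halves, the bound on the noise amplitude divided by the
    squared distance drops by the factor \<open>s\<close>, so the Gaussians may grow like
    \<open>1 / s ^ k\<close>.\<close>
  define s :: real where "s = 2 powr - \<beta>"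
  have \<beta>: "\<beta> > 0" using alpha by (simp add: \<beta>_def)
  have s: "0 < s" "s < 1" using \<beta> by (auto simp: s_def powr_less_one)
  obtain T where T: "T > 0" "\<And>n. 1 / 2 \<le> \<P>(\<omega> in M. \<forall>k. norm (Z (n + k) \<omega>) \<le> T / s ^ k)"
    by (rule gauss_tails[of Z, OF gaussian s]) (rule that)

  \<comment> \<open>\<open>L / m\<close> pays for the Newton step and 1 for the noise; the sum
    exceeds \<open>L / (2 * m)\<close>.\<close>
  define Q where "Q = L / m + 1"
  define C where "C = onorm ((*v) (hessian g p)) + L * r\<^sub>0 + 1"
  have Q: "Q > L / (2 * m)" "Q > 1"
    using constants by (auto simp: Q_def field_simps)
  have C: "C > 0"
    using constants onorm_pos_le[of "(*v) (hessian g p)"]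
    by (simp add: C_def add_nonneg_pos)
  \<comment> \<open>The three bounds keep the \<open>r\<close>-ball inside the chart, make the
    schedule at least halve, and let the noise fit into its share.\<close>
  define r where "r = min (r\<^sub>0 / 2) (min (1 / (2 * Q)) ((1 / (C powr \<alpha> * T)) powr (1 / \<beta>)))"
  have r: "0 < r" "r < r\<^sub>0" using constants Q C T by (auto simp: r_def)
  have Qr: "Q * r \<le> 1 / 2"
  proof -
    have "r \<le> 1 / (2 * Q)" by (simp add: r_def)
    then show ?thesis using Q(2) by (simp add: field_simps)
  qed
  have small: "C powr \<alpha> * r powr \<beta> * T \<le> 1"
  proof -
    have "r powr \<beta> \<le> ((1 / (C powr \<alpha> * T)) powr (1 / \<beta>)) powr \<beta>"
      using r(1) \<beta> by (intro powr_mono2) (auto simp: r_def)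
    also have "\<dots> = 1 / (C powr \<alpha> * T)"
      using \<beta> C T(1) by (simp add: powr_powr)
    finally show ?thesis using C T(1) by (simp add: field_simps)
  qed
  define a where "a = rec_nat r (\<lambda>_ x. Q * x\<^sup>2)"
  have a: "a 0 = r" "a (Suc k) = Q * (a k)\<^sup>2" for k by (simp_all add: a_def)
  have ab: "0 < a k" "a k \<le> r / 2 ^ k" for k
    using quadratic_schedule_bounds[OF a r(1) _ Qr, of k] Q(2) by auto
  have ar: "a k \<le> r" for k
    using order_trans[OF ab(2)[of k], of r] r(1) by (simp add: divide_le_eq mult_le_cancel_left1)

  \<comment> \<open>Following the schedule and entering the ball\<close>
  define S where "S = lift_step g \<alpha>"
  \<comment> \<open>Distances are measured on the torus, since the lifted chain may sit near any
    lattice translate of \<open>p\<close>.\<close>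
  define d where "d x = dist (to_torus x) xstar" for x
  have near: "\<exists>y. to_torus y = x \<and> dist x xstar = norm (y - p)" for x
    using dist_torus_attained[of x p] chart_centre by (metis dist_commute dist_norm)
  have local: "norm (S y z - p) \<le> a (Suc k)" if y: "norm (y - p) \<le> a k" and z: "norm z \<le> T / s ^ k" for y z k
  proof -
    define N where "N = y - (if invertible (hessian g y) then matrix_inv (hessian g y) *v gradient g y else 0) - p"
    have yb: "y \<in> ball p r\<^sub>0"
      using y ar[of k] r(2) by (simp add: dist_norm norm_minus_commute)
    have "S y z - p = N + (g y powr \<alpha>) *\<^sub>R z"
      by (simp add: S_def lift_step_def N_def)
    then have "norm (S y z - p) \<le> norm N + g y powr \<alpha> * norm z"
      using norm_triangle_ineq[of N "(g y powr \<alpha>) *\<^sub>R z"] by simp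
    also have "\<dots> \<le> Q * (a k)\<^sup>2"
    proof (rule noisy_step_contraction[OF _ _ nonneg _ norm_ge_zero y ab C norm_ge_zero _ alpha])
      show "norm N \<le> (Q - 1) * (norm (y - p))\<^sup>2"
        using newton_step_quadratic[OF g constants(2) crit convex' lip' _ yb] constants by (simp add: Q_def N_def)
      show "g y \<le> C * (norm (y - p))\<^sup>2"
        by (rule order_trans[OF quadratic_upper_bound[OF g gp crit lip' less_imp_le[OF constants(3)] yb]])
          (auto simp: C_def intro!: mult_right_mono)
      show "norm z \<le> T / (2 powr - (2 * \<alpha> - 2)) ^ k" using z by (simp add: s_def \<beta>_def)
      show "C powr \<alpha> * r powr (2 * \<alpha> - 2) * T \<le> 1" using small by (simp add: \<beta>_def)
    qed (use Q in simp)
    finally show ?thesis by (simp add: a)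
  qed
  have torus_step: "to_torus (S x z) = noisy_newton_step f \<alpha> (to_torus x) z" for x z
    unfolding S_def g_def by (rule to_torus_lift_step)
  have follow: "d (S x z) \<le> a (Suc k)" if x: "d x \<le> a k" and z: "z \<in> {z. norm z \<le> T / s ^ k}" for x z k
  proof -
    obtain y where y: "to_torus y = to_torus x" "d x = norm (y - p)"
      using near[of "to_torus x"] by (auto simp: d_def)
    \<comment> \<open>The lifted point \<open>x\<close> may lie far from \<open>p\<close>; as the
      projected step depends only on \<open>to_torus x\<close>, the representative \<open>y\<close>
      near \<open>p\<close> can replace it.\<close>
    have "to_torus (S x z) = to_torus (S y z)" using y(1) by (simp add: torus_step)
    then have "d (S x z) \<le> norm (S y z - p)"
      using dist_to_torus_le[of "S y z" p] chart_centre by (simp add: d_def dist_norm)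
    also have "\<dots> \<le> a (Suc k)" using x z y(2) by (intro local) auto
    finally show ?thesis .
  qed
  have contg: "continuous_on UNIV (f \<circ> to_torus)"
    using C2_continuous[OF g] by (simp add: g_def)
  obtain \<delta> where \<delta>: "\<delta> > 0" "\<And>x. d x > r \<Longrightarrow> ennreal \<delta> \<le> emeasure gauss {z. d (S x z) \<le> r}"
    using lift_step_hits_ball[of f p r \<alpha>, OF contg _ r(1)] pos alpha
    unfolding d_def S_def g_def chart_centre by auto
  have "continuous_on UNIV d"
    unfolding d_def by (intro continuous_on_dist continuous_on_to_torus continuous_on_const)
  then have dm: "d \<in> borel_measurable borel" by (rule borel_measurable_continuous_onI)

  \<comment> \<open>Almost sure capture and convergence\<close>
  have captured: "AE \<omega> in M. \<exists>N. \<forall>k. dist (noisy_newton f \<alpha> Z x\<^sub>0 (N + k) \<omega>) xstar \<le> a k" for x\<^sub>0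
  proof -
    have "AE \<omega> in M. \<exists>N. \<forall>k. d (noise_chain S Z (torus_rep x\<^sub>0) (N + k) \<omega>) \<le> a k"
    proof (rule noise_chain_eventually_captured[where V = "\<lambda>k. {z. norm z \<le> T / s ^ k}" and q = "1 / 2"
          and \<mu> = gauss and \<delta> = \<delta>, OF _ dm indep])
      show "(\<lambda>(x, z). S x z) \<in> borel \<Otimes>\<^sub>M borel \<rightarrow>\<^sub>M borel"
        unfolding S_def by (rule measurable_lift_step[OF g])
      show "distr M borel (Z n) = gauss" for n by (rule std_gaussian_vector_distr(2)[OF gaussian])
      show "{z. norm z \<le> T / s ^ k} \<in> sets borel" for k by measurable
    qed (use T(2) follow \<delta> in \<open>simp_all add: a\<close>)
    then show ?thesis
      unfolding d_def S_def g_def by (simp only: to_torus_noise_chain to_torus_rep)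
  qed
  have "(\<lambda>k. r / 2 ^ k) \<longlonglongrightarrow> 0"
    by (rule LIMSEQ_divide_realpow_zero) simp
  then have a0: "a \<longlonglongrightarrow> 0"
    by (rule tendsto_sandwich[OF _ _ tendsto_const, rotated 2])
      (use ab in \<open>auto intro!: always_eventually simp: less_imp_le\<close>)
  have "AE \<omega> in M. (\<lambda>n. noisy_newton f \<alpha> Z x\<^sub>0 n \<omega>) \<longlonglongrightarrow> xstar" for x\<^sub>0
    using captured[of x\<^sub>0]
  proof eventually_elim
    case (elim \<omega>)
    then obtain N where N: "\<And>k. dist (noisy_newton f \<alpha> Z x\<^sub>0 (N + k) \<omega>) xstar \<le> a k" by blast
    have "(\<lambda>k. dist (noisy_newton f \<alpha> Z x\<^sub>0 (k + N) \<omega>) xstar) \<longlonglongrightarrow> 0"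
      by (rule tendsto_sandwich[OF _ _ tendsto_const a0])
        (use N in \<open>auto intro!: always_eventually simp: add.commute\<close>)
    then show ?case
      using LIMSEQ_offset tendsto_dist_iff by blast
  qed
  moreover have "AE \<omega> in M. \<exists>N. \<forall>k. \<exists>y\<in>ball p r\<^sub>0.
      to_torus y = noisy_newton f \<alpha> Z x\<^sub>0 (N + k) \<omega> \<and> norm (y - p) \<le> a k" for x\<^sub>0
    using captured[of x\<^sub>0]
  proof eventually_elim
    case (elim \<omega>)
    then obtain N where N: "\<And>k. dist (noisy_newton f \<alpha> Z x\<^sub>0 (N + k) \<omega>) xstar \<le> a k" by blast
    have "\<exists>y\<in>ball p r\<^sub>0. to_torus y = noisy_newton f \<alpha> Z x\<^sub>0 (N + k) \<omega> \<and> norm (y - p) \<le> a k" for k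
    proof -
      obtain y where y: "to_torus y = noisy_newton f \<alpha> Z x\<^sub>0 (N + k) \<omega>" "norm (y - p) \<le> a k"
        using near N[of k] by metis
      moreover from y(2) have "y \<in> ball p r\<^sub>0"
        using ar[of k] r(2) by (simp add: dist_norm norm_minus_commute)
      ultimately show ?thesis by blast
    qed
    then show ?case by blast
  qed
  moreover have "Q * r < 1" using Qr by simp
  ultimately show ?thesis using r Q(1) a by blast
qed

end
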